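(* Let $m,n\ge1$, $\mathfrak g=\mathfrak{gl}(m,n)$ with its distinguished Borel subalgebra, and $\eta=\epsilon_1-\delta_n$. Let $\lambda\in\mathfrak h^*$, let $v$ be a highest weight vector of weight $\lambda$ in the Verma module $M(\lambda)$, and set $$\Theta_\eta=\sum_{J\in\mathbb I} f_J H_J .$$ Then $\Theta_\eta v$ is a $\mathfrak g_0$-highest weight vector. If moreover $(\lambda+\rho,\eta)=0$, then $\Theta_\eta v$ is a $\mathfrak g$-highest weight vector; and hence $\Theta_\eta$ is a Šapovalov element for the pair $(\eta,1)$.
   Context: Ground field $\mathbb C$. $\mathfrak g=\mathfrak{gl}(m,n)$ is the general linear Lie superalgebra with matrix units $e_{i,j}$, $1\le i,j\le m+n$; $e_{i,j}$ is even iff $i,j$ are both $\le m$ or both $>m$; $\mathfrak g_0$ is the even part. $\mathfrak h$ is the diagonal subalgebra; $\epsilon_i,\delta_j\in\mathfrak h^*$ are the basis dual to $e_{i,i}$ ($i\le m$), $e_{m+j,m+j}$ ($j\le n$); $(\epsilon_i,\epsilon_j)=\delta_{ij}=-(\delta_i,\delta_j)$, $(\epsilon_i,\delta_j)=0$. For $\alpha\in\mathfrak h^*$, $h_\alpha\in\mathfrak h$ satisfies $\beta(h_\alpha)=(\alpha,\beta)$ for all $\beta$. The distinguished Borel subalgebra is the upper triangular one; $\mathfrak n^+,\mathfrak n^-$ are the strictly upper, lower triangular matrices, $\mathfrak b^-=\mathfrak h\oplus\mathfrak n^-$; $\Delta^+=\Delta_0^+\cup\Delta_1^+$ (even, odd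 positive roots), $\Pi$ the simple roots, $\rho=\frac12\sum_{\alpha\in\Delta_0^+}\alpha-\frac12\sum_{\alpha\in\Delta_1^+}\alpha$. A $\mathfrak g_0$- (resp. $\mathfrak g$-) highest weight vector is a nonzero weight vector killed by $\mathfrak n^+\cap\mathfrak g_0$ (resp. $\mathfrak n^+$). Elements $f_J,H_J$: $\mathbb I=\{I\subseteq\{1,\dots,m+n\}:1,m+n\in I\}$. If $I=\{i_0>i_1>\dots>i_{s+1}\}$, then $f_I=e_{i_0,i_1}e_{i_1,i_2}\cdots e_{i_s,i_{s+1}}$. Put $\sigma_i=\epsilon_1-\epsilon_{i+1}$ for $1\le i\le m-1$, $\tau_i=\delta_i-\delta_n$ for $1\le i\le n-1$, and $$h_i=\begin{cases}h_{\sigma_i}+(\rho,\sigma_i)-1,&1\le i\le m-1,\\ h_{\tau_{i+1-m}}+(\rho,\tau_{i+1-m}),&m\le i\le m+n-2.\end{cases}$$ For $I\in\mathbb I$ let $r(I)=\{x-1:x\in\{1,\dots,m+n\}\setminus I\}$ and $H_I=\prod_{i\in r(I)}h_i$ (empty product $=1$). Šapovalov element for $(\eta,1)$: an element $\theta\in U(\mathfrak b^-)$ of weight $-\eta$ of the form $\theta=\sum_\pi e_{-\pi}H_\pi$ with $H_\pi\in U(\mathfrak h)$, where $\pi$ runs over the partitions of $\eta$ (functions $\pi:\Delta^+\to\mathbb Z_{\ge0}$ with $\sum_\alpha\pi(\alpha)\alpha=\eta$ and $\pi(\alpha)\le1$ for $\alpha$ odd) and $e_{-\pi}$ is the product of the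 $e_{-\alpha}^{\pi(\alpha)}$ in a fixed order on $\Delta^+$ (the $f_J$ are such monomials), such that $H_{\pi^0}=1$ for the unique partition $\pi^0$ vanishing off $\Pi$, and $e_\alpha\theta\in U(\mathfrak g)(h_\eta+\rho(h_\eta))+U(\mathfrak g)\mathfrak n^+$ for all $\alpha\in\Delta^+$ (note $(\eta,\eta)=0$). *)

theory Defs
  imports Complex_Main "HOL-Library.Poly_Mapping"
begin

text \<open>
  The free associative algebra \<open>\<complex>\<langle>e i j\<rangle>\<close> is the monoid algebra over \<open>\<complex>\<close> of the free monoid of
  words in letters \<open>(i, j)\<close>. The words are wrapped so as not to put a \<open>monoid_add\<close> instance on
  \<open>list\<close>.
\<close>

datatype word = Word (letters: "(nat \<times> nat) list")

instantiation word :: monoid_add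
begin
definition zero_word :: word where "0 = Word []"
definition plus_word :: "word \<Rightarrow> word \<Rightarrow> word" where "u + w = Word (letters u @ letters w)"
instance by standard (simp_all add: zero_word_def plus_word_def)
end

type_synonym free_alg = "word \<Rightarrow>\<^sub>0 complex"

definition gen :: "nat \<Rightarrow> nat \<Rightarrow> free_alg" where
  "gen i j = Poly_Mapping.single (Word [(i, j)]) 1"

definition scal :: "complex \<Rightarrow> free_alg" where
  "scal c = Poly_Mapping.single 0 c"

inductive_set two_sided_ideal :: "'a::ring_1 set \<Rightarrow> 'a set" for S where
  zero: "0 \<in> two_sided_ideal S"
| mult: "s \<in> S \<Longrightarrow> a * s * b \<in> two_sided_ideal S"
| add: "x \<in> two_sided_ideal S \<Longrightarrow> y \<in> two_sided_ideal S \<Longrightarrow> x + y \<in> two_sided_ideal S"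

inductive_set left_ideal :: "'a::ring_1 set \<Rightarrow> 'a set" for S where
  zero: "0 \<in> left_ideal S"
| mult: "s \<in> S \<Longrightarrow> a * s \<in> left_ideal S"
| add: "x \<in> left_ideal S \<Longrightarrow> y \<in> left_ideal S \<Longrightarrow> x + y \<in> left_ideal S"

inductive_set subalg :: "free_alg set \<Rightarrow> free_alg set" for S where
  scal: "scal c \<in> subalg S"
| base: "s \<in> S \<Longrightarrow> s \<in> subalg S"
| add: "x \<in> subalg S \<Longrightarrow> y \<in> subalg S \<Longrightarrow> x + y \<in> subalg S"
| mult: "x \<in> subalg S \<Longrightarrow> y \<in> subalg S \<Longrightarrow> x * y \<in> subalg S"

definition odd_unit :: "nat \<Rightarrow> nat \<Rightarrow> nat \<Rightarrow> bool" where
  "odd_unit m i j \<longleftrightarrow> (i \<le> m) \<noteq> (j \<le> m)"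

text \<open>
  \<open>U(gl(m,n))\<close> is the quotient of the free algebra by the ideal generated by \<open>gl_relations\<close>. Its
  elements are given by representatives in the free algebra, equality being \<open>U_eq\<close>. Letters with
  an index outside \<open>{1..m+n}\<close> are set to zero, so that no carrier is needed.
\<close>

definition gl_relations :: "nat \<Rightarrow> nat \<Rightarrow> free_alg set" where
  "gl_relations m n =
     {gen i j * gen k l
        - (if odd_unit m i j \<and> odd_unit m k l then -1 else 1) * gen k l * gen i j
        - ((if j = k then gen i l else 0)
           - (if odd_unit m i j \<and> odd_unit m k l then -1 else 1) * (if i = l then gen k j else 0))
      | i j k l. {i, j, k, l} \<subseteq> {1..m+n}}
     \<union> {gen i j | i j. \<not> {i, j} \<subseteq> {1..m+n}}"

definition U_eq :: "nat \<Rightarrow> nat \<Rightarrow> free_alg \<Rightarrow> free_alg \<Rightarrow> bool" where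
  "U_eq m n x y \<longleftrightarrow> x - y \<in> two_sided_ideal (gl_relations m n)"

definition h_gens :: "nat \<Rightarrow> nat \<Rightarrow> free_alg set" where
  "h_gens m n = {gen i i | i. i \<in> {1..m+n}}"

definition n_plus :: "nat \<Rightarrow> nat \<Rightarrow> free_alg set" where
  "n_plus m n = {gen i j | i j. 1 \<le> i \<and> i < j \<and> j \<le> m+n}"

definition b_minus :: "nat \<Rightarrow> nat \<Rightarrow> free_alg set" where
  "b_minus m n = {gen i j | i j. 1 \<le> j \<and> j \<le> i \<and> i \<le> m+n}"

text \<open>
  A weight is given by its coordinates in the basis of \<open>\<hh>\<^sup>*\<close> dual to \<open>e\<^sub>1\<^sub>,\<^sub>1, \<dots>, e\<^sub>m\<^sub>+\<^sub>n\<^sub>,\<^sub>m\<^sub>+\<^sub>n\<close>; i.e.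
  \<open>a k\<close> is the value of \<open>a\<close> at \<open>e\<^sub>k\<^sub>,\<^sub>k\<close>. Only the coordinates with \<open>k \<in> {1..m+n}\<close> matter.
\<close>

type_synonym weight = "nat \<Rightarrow> complex"

definition dual :: "nat \<Rightarrow> weight" where
  "dual i = (\<lambda>k. if k = i then 1 else 0)"

definition eps :: "nat \<Rightarrow> weight" where "eps i = dual i"

definition del :: "nat \<Rightarrow> nat \<Rightarrow> weight" where "del m j = dual (m + j)"

definition bil :: "nat \<Rightarrow> nat \<Rightarrow> weight \<Rightarrow> weight \<Rightarrow> complex" where
  "bil m n a b = (\<Sum>k\<in>{1..m}. a k * b k) - (\<Sum>k\<in>{m+1..m+n}. a k * b k)"

text \<open>The coefficient of \<open>e\<^sub>k\<^sub>,\<^sub>k\<close> in \<open>h\<^sub>a\<close> is the value of \<open>dual k\<close> at \<open>h\<^sub>a\<close>, i.e. \<open>(a, dual k)\<close>.\<close>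

definition h_of :: "nat \<Rightarrow> nat \<Rightarrow> weight \<Rightarrow> free_alg" where
  "h_of m n a = (\<Sum>k\<in>{1..m+n}. scal (bil m n a (dual k)) * gen k k)"

text \<open>The pair \<open>(i, j)\<close>, \<open>i < j\<close>, stands for the positive root of \<open>e\<^sub>i\<^sub>,\<^sub>j\<close>.\<close>

definition pos_roots :: "nat \<Rightarrow> nat \<Rightarrow> (nat \<times> nat) set" where
  "pos_roots m n = {(i, j). 1 \<le> i \<and> i < j \<and> j \<le> m+n}"

definition odd_root :: "nat \<Rightarrow> nat \<times> nat \<Rightarrow> bool" where
  "odd_root m = (\<lambda>(i, j). odd_unit m i j)"

definition simple_roots :: "nat \<Rightarrow> nat \<Rightarrow> (nat \<times> nat) set" where
  "simple_roots m n = {(i, i + 1) | i. 1 \<le> i \<and> i + 1 \<le> m+n}"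

definition root_weight :: "nat \<times> nat \<Rightarrow> weight" where
  "root_weight = (\<lambda>(i, j) k. dual i k - dual j k)"

definition rho :: "nat \<Rightarrow> nat \<Rightarrow> weight" where
  "rho m n = (\<lambda>k. (\<Sum>\<alpha>\<in>{\<alpha> \<in> pos_roots m n. \<not> odd_root m \<alpha>}. root_weight \<alpha> k) / 2
                - (\<Sum>\<alpha>\<in>{\<alpha> \<in> pos_roots m n. odd_root m \<alpha>}. root_weight \<alpha> k) / 2)"

definition eta :: "nat \<Rightarrow> nat \<Rightarrow> weight" where
  "eta m n = (\<lambda>k. eps 1 k - del m n k)"

definition verma_ideal :: "nat \<Rightarrow> nat \<Rightarrow> weight \<Rightarrow> free_alg set" where
  "verma_ideal m n lam = left_ideal
     (two_sided_ideal (gl_relations m n) \<union> n_plus m n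
      \<union> {gen i i - scal (lam i) | i. i \<in> {1..m+n}})"

text \<open>
  \<open>M(\<lambda>) = U(\<gg>) / (U(\<gg>) \<nn>\<^sup>+ + \<Sum>h\<in>\<hh>. U(\<gg>) (h - \<lambda>(h)))\<close>, realised directly as a quotient
  of the free algebra; vectors are cosets, and the zero vector is \<open>verma_ideal m n lam\<close> itself.
\<close>

definition verma_coset :: "nat \<Rightarrow> nat \<Rightarrow> weight \<Rightarrow> free_alg \<Rightarrow> free_alg set" where
  "verma_coset m n lam x = {y. y - x \<in> verma_ideal m n lam}"

definition verma :: "nat \<Rightarrow> nat \<Rightarrow> weight \<Rightarrow> free_alg set set" where
  "verma m n lam = range (verma_coset m n lam)"

definition verma_act :: "nat \<Rightarrow> nat \<Rightarrow> weight \<Rightarrow> free_alg \<Rightarrow> free_alg set \<Rightarrow> free_alg set" where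
  "verma_act m n lam u v = (\<Union>x\<in>v. verma_coset m n lam (u * x))"

definition weight_vector :: "nat \<Rightarrow> nat \<Rightarrow> weight \<Rightarrow> weight \<Rightarrow> free_alg set \<Rightarrow> bool" where
  "weight_vector m n lam \<mu> v \<longleftrightarrow>
     v \<in> verma m n lam \<and> v \<noteq> verma_coset m n lam 0 \<and>
     (\<forall>i\<in>{1..m+n}. verma_act m n lam (gen i i) v = verma_act m n lam (scal (\<mu> i)) v)"

text \<open>
  Here \<open>lam\<close> is the parameter of the Verma module and \<open>\<mu>\<close> the weight of the vector.
\<close>

definition highest_weight_vector :: "nat \<Rightarrow> nat \<Rightarrow> weight \<Rightarrow> weight \<Rightarrow> free_alg set \<Rightarrow> bool" where
  "highest_weight_vector m n lam \<mu> v \<longleftrightarrow> weight_vector m n lam \<mu> v \<and>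
     (\<forall>(i, j)\<in>pos_roots m n. verma_act m n lam (gen i j) v = verma_coset m n lam 0)"

definition even_highest_weight_vector ::
  "nat \<Rightarrow> nat \<Rightarrow> weight \<Rightarrow> weight \<Rightarrow> free_alg set \<Rightarrow> bool" where
  "even_highest_weight_vector m n lam \<mu> v \<longleftrightarrow> weight_vector m n lam \<mu> v \<and>
     (\<forall>(i, j)\<in>{\<alpha> \<in> pos_roots m n. \<not> odd_root m \<alpha>}.
        verma_act m n lam (gen i j) v = verma_coset m n lam 0)"

definition index_sets :: "nat \<Rightarrow> nat \<Rightarrow> nat set set" where
  "index_sets m n = {I. I \<subseteq> {1..m+n} \<and> 1 \<in> I \<and> m+n \<in> I}"

definition f_elt :: "nat set \<Rightarrow> free_alg" where
  "f_elt I = (let is = rev (sorted_list_of_set I)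
              in prod_list (map (\<lambda>(i, j). gen i j) (zip is (tl is))))"

definition sigma :: "nat \<Rightarrow> weight" where
  "sigma i = (\<lambda>k. eps 1 k - eps (i + 1) k)"

definition tau :: "nat \<Rightarrow> nat \<Rightarrow> nat \<Rightarrow> weight" where
  "tau m n i = (\<lambda>k. del m i k - del m n k)"

definition h_elt :: "nat \<Rightarrow> nat \<Rightarrow> nat \<Rightarrow> free_alg" where
  "h_elt m n i =
     (if i \<le> m - 1
      then h_of m n (sigma i) + scal (bil m n (rho m n) (sigma i) - 1)
      else h_of m n (tau m n (i + 1 - m)) + scal (bil m n (rho m n) (tau m n (i + 1 - m))))"

definition r_set :: "nat \<Rightarrow> nat \<Rightarrow> nat set \<Rightarrow> nat set" where
  "r_set m n I = {x - 1 | x. x \<in> {1..m+n} - I}"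

text \<open>The factors commute in \<open>U(\<gg>)\<close>, so listing them in increasing order is immaterial.\<close>

definition H_elt :: "nat \<Rightarrow> nat \<Rightarrow> nat set \<Rightarrow> free_alg" where
  "H_elt m n I = prod_list (map (h_elt m n) (sorted_list_of_set (r_set m n I)))"

definition Theta :: "nat \<Rightarrow> nat \<Rightarrow> free_alg" where
  "Theta m n = (\<Sum>J\<in>index_sets m n. f_elt J * H_elt m n J)"

definition partitions :: "nat \<Rightarrow> nat \<Rightarrow> weight \<Rightarrow> (nat \<times> nat \<Rightarrow> nat) set" where
  "partitions m n \<gamma> =
     {\<pi>. (\<forall>\<alpha>. \<alpha> \<notin> pos_roots m n \<longrightarrow> \<pi> \<alpha> = 0) \<and>
         (\<forall>\<alpha>\<in>pos_roots m n. odd_root m \<alpha> \<longrightarrow> \<pi> \<alpha> \<le> 1) \<and>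
         (\<forall>k. (\<Sum>\<alpha>\<in>pos_roots m n. of_nat (\<pi> \<alpha>) * root_weight \<alpha> k) = \<gamma> k)}"

definition e_minus :: "(nat \<times> nat) list \<Rightarrow> (nat \<times> nat \<Rightarrow> nat) \<Rightarrow> free_alg" where
  "e_minus ord \<pi> = prod_list (map (\<lambda>(i, j). gen j i ^ \<pi> (i, j)) ord)"

text \<open>
  Orders on the positive roots, given as enumerations, for which the \<open>f_elt J\<close> are among the
  monomials \<open>e_minus ord \<pi>\<close>; e.g. listing the pairs \<open>(i, j)\<close> by decreasing \<open>j\<close>.
\<close>

definition admissible_order :: "nat \<Rightarrow> nat \<Rightarrow> (nat \<times> nat) list \<Rightarrow> bool" where
  "admissible_order m n ord \<longleftrightarrow> distinct ord \<and> set ord = pos_roots m n \<and>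
     (\<forall>J\<in>index_sets m n. \<exists>\<pi>\<in>partitions m n (eta m n). f_elt J = e_minus ord \<pi>)"

text \<open>
  Sapovalov elements for the pair \<open>(\<gamma>, 1)\<close>, where \<open>\<gamma>\<close> is isotropic; \<open>\<rho>(h\<^sub>\<gamma>) = (\<rho>, \<gamma>)\<close>. The
  second conjunct says that \<open>\<theta>\<close> has weight \<open>-\<gamma>\<close> for the adjoint action.
\<close>

definition sapovalov_element ::
  "nat \<Rightarrow> nat \<Rightarrow> (nat \<times> nat) list \<Rightarrow> weight \<Rightarrow> free_alg \<Rightarrow> bool" where
  "sapovalov_element m n ord \<gamma> \<theta> \<longleftrightarrow>
     (\<exists>x\<in>subalg (b_minus m n). U_eq m n \<theta> x) \<and>
     (\<forall>i\<in>{1..m+n}. U_eq m n (gen i i * \<theta> - \<theta> * gen i i) (scal (- \<gamma> i) * \<theta>)) \<and>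
     (\<exists>H. (\<forall>\<pi>\<in>partitions m n \<gamma>. H \<pi> \<in> subalg (h_gens m n)) \<and>
          U_eq m n \<theta> (\<Sum>\<pi>\<in>partitions m n \<gamma>. e_minus ord \<pi> * H \<pi>) \<and>
          (\<forall>\<pi>\<in>partitions m n \<gamma>.
             (\<forall>\<alpha>. \<alpha> \<notin> simple_roots m n \<longrightarrow> \<pi> \<alpha> = 0) \<longrightarrow> U_eq m n (H \<pi>) 1)) \<and>
     (\<forall>(i, j)\<in>pos_roots m n. \<exists>a. \<exists>b\<in>left_ideal (n_plus m n).
        U_eq m n (gen i j * \<theta>) (a * (h_of m n \<gamma> + scal (bil m n (rho m n) \<gamma>)) + b))"

end

theory Submission
  imports Defs
begin

text \<open>
  Splitting off the largest element of a chain gives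
  \<open>T\<^sub>k = \<Sum>b<k. e\<^sub>k\<^sub>b T\<^sub>b A\<^sub>b\<^sub>k\<close> with \<open>\<Theta> = T\<^sub>m\<^sub>+\<^sub>n\<close> and \<open>A\<^sub>b\<^sub>k\<close> a product of factors \<open>h\<close>. Modulo
  \<open>U(\<gg>)\<nn>\<^sup>+\<close> the simple root vector \<open>e\<^sub>p\<^sub>,\<^sub>p\<^sub>+\<^sub>1\<close> kills \<open>T\<^sub>k\<close> for \<open>k \<le> p\<close> and maps \<open>T\<^sub>p\<^sub>+\<^sub>1\<close> to \<open>T\<^sub>p\<close> times
  an element of \<open>U(\<hh>)\<close>; in \<open>e\<^sub>p\<^sub>,\<^sub>p\<^sub>+\<^sub>1 T\<^sub>k\<close> with \<open>k > p + 1\<close> the terms then cancel if \<open>p \<noteq> m\<close>, and add up to a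
  multiple of \<open>h\<^sub>\<eta> + \<rho>(h\<^sub>\<eta>)\<close> if \<open>p = m\<close>.

  A highest weight vector of weight \<open>\<lambda>\<close> in \<open>M(\<lambda>)\<close> is a multiple of the generator \<open>v\<^sub>\<lambda>\<close>, so it remains
  to see that \<open>\<Theta> v\<^sub>\<lambda> \<noteq> 0\<close>. For this one maps \<open>M(\<lambda>)\<close> to the tensor product of \<open>M(\<lambda>)\<close> with a dual of the
  functions on the big cell of the flag supermanifold; there the term of \<open>\<Theta>\<close> for the full chain,
  whose coefficient is \<open>1\<close>, takes the value \<open>v\<^sub>\<lambda>\<close> on a function on which all other terms vanish.
\<close>

section \<open>Ideals, scalars and induction in the free algebra\<close>

lemma left_ideal_base: "s \<in> S \<Longrightarrow> s \<in> left_ideal S"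
  using left_ideal.mult[of s S 1] by simp

lemma left_ideal_lmult: "x \<in> left_ideal S \<Longrightarrow> a * x \<in> left_ideal S"
proof (induction rule: left_ideal.induct)
  case zero
  then show ?case by (simp add: left_ideal.zero)
next
  case (mult s b)
  then show ?case using left_ideal.mult[of s S "a * b"] by (simp add: mult.assoc)
next
  case (add x y)
  then show ?case by (simp add: distrib_left left_ideal.add)
qed

lemma left_ideal_mono: "S \<subseteq> S' \<Longrightarrow> left_ideal S \<subseteq> left_ideal S'"
  by (rule subsetI, erule left_ideal.induct) (auto intro: left_ideal.intros)

lemma two_sided_ideal_base: "s \<in> S \<Longrightarrow> s \<in> two_sided_ideal S"
  using two_sided_ideal.mult[of s S 1 1] by simp

lemma two_sided_ideal_lmult: "x \<in> two_sided_ideal S \<Longrightarrow> a * x \<in> two_sided_ideal S"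
proof (induction rule: two_sided_ideal.induct)
  case zero
  then show ?case by (simp add: two_sided_ideal.zero)
next
  case (mult s b c)
  then show ?case using two_sided_ideal.mult[of s S "a * b" c] by (simp add: mult.assoc)
next
  case (add x y)
  then show ?case by (simp add: distrib_left two_sided_ideal.add)
qed

lemma two_sided_ideal_rmult: "x \<in> two_sided_ideal S \<Longrightarrow> x * a \<in> two_sided_ideal S"
proof (induction rule: two_sided_ideal.induct)
  case zero
  then show ?case by (simp add: two_sided_ideal.zero)
next
  case (mult s b c)
  then show ?case using two_sided_ideal.mult[of s S b "c * a"] by (simp add: mult.assoc)
next
  case (add x y)
  then show ?case by (simp add: distrib_right two_sided_ideal.add)
qed

lemma two_sided_ideal_uminus: "x \<in> two_sided_ideal S \<Longrightarrow> - x \<in> two_sided_ideal S"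
  using two_sided_ideal_lmult[of x S "-1"] by simp

lemma scal_0 [simp]: "scal 0 = 0" and scal_1 [simp]: "scal 1 = 1"
  by (simp_all add: scal_def)

lemma scal_add: "scal (a + b) = scal a + scal b"
  and scal_mult: "scal (a * b) = scal a * scal b"
  and scal_uminus: "scal (- a) = - scal a"
  by (simp_all add: scal_def single_add mult_single single_uminus)

lemma scal_diff: "scal (a - b) = scal a - scal b"
  using scal_add[of a "- b"] by (simp add: scal_uminus)

lemma scal_of_nat: "scal (of_nat k) = of_nat k"
  by (induction k) (simp_all add: scal_add)

lemma free_alg_induct [case_names single add]:
  fixes p :: free_alg
  assumes "\<And>w c. P (Poly_Mapping.single w c)" and "\<And>p q. P p \<Longrightarrow> P q \<Longrightarrow> P (p + q)"
  shows "P p"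
proof (induction p rule: update_induct)
  case const
  show ?case using assms(1)[of 0 0] by simp
next
  case (update f a b)
  have "Poly_Mapping.update a b f = f + Poly_Mapping.single a b"
    using update(1) by (intro poly_mapping_eqI)
      (auto simp: lookup_update lookup_add lookup_single not_in_keys_iff_lookup_eq_zero when_def)
  then show ?case using assms update by simp
qed

lemma scal_commute: "scal c * x = x * scal c"
proof (induction x rule: free_alg_induct)
  case (single w c)
  then show ?case by (simp add: scal_def mult_single mult.commute)
next
  case (add f g)
  then show ?case by (simp add: distrib_left distrib_right)
qed

text \<open>Such an \<open>L\<close> is the preimage of a left ideal of U(gl(m,n)), so congruence
  modulo \<open>L\<close> is equality in a cyclic module. This covers the Verma module as well as
  the quotients by the left ideals generated by \<open>n_plus\<close>, with or without
  \<open>zeta\<close>.\<close>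

locale gl_left_ideal =
  fixes m n :: nat and L :: "free_alg set"
  assumes add_mem: "x \<in> L \<Longrightarrow> y \<in> L \<Longrightarrow> x + y \<in> L"
    and lmult_mem: "x \<in> L \<Longrightarrow> a * x \<in> L"
    and relations_mem: "x \<in> two_sided_ideal (gl_relations m n) \<Longrightarrow> x \<in> L"
begin

definition eqv :: "free_alg \<Rightarrow> free_alg \<Rightarrow> bool" (infix "\<approx>" 50) where
  "x \<approx> y \<longleftrightarrow> x - y \<in> L"

lemma zero_mem: "0 \<in> L"
  by (rule relations_mem) (rule two_sided_ideal.zero)

lemma uminus_mem: "x \<in> L \<Longrightarrow> - x \<in> L"
  using lmult_mem[of x "-1"] by simp

lemma diff_mem: "x \<in> L \<Longrightarrow> y \<in> L \<Longrightarrow> x - y \<in> L"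
  using add_mem[of x "- y"] uminus_mem by auto

lemma sum_mem: "(\<And>i. i \<in> A \<Longrightarrow> f i \<in> L) \<Longrightarrow> sum f A \<in> L"
  by (induction A rule: infinite_finite_induct) (auto simp: zero_mem add_mem)

lemma eqv_refl [simp]: "x \<approx> x"
  by (simp add: eqv_def zero_mem)

lemma eqv_sym: "x \<approx> y \<Longrightarrow> y \<approx> x"
  using uminus_mem[of "x - y"] by (simp add: eqv_def)

lemma eqv_trans [trans]: "x \<approx> y \<Longrightarrow> y \<approx> z \<Longrightarrow> x \<approx> z"
  using add_mem[of "x - y" "y - z"] by (simp add: eqv_def)

lemma eqv_add: "x \<approx> y \<Longrightarrow> x' \<approx> y' \<Longrightarrow> x + x' \<approx> y + y'"
  using add_mem[of "x - y" "x' - y'"] by (simp add: eqv_def algebra_simps)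

lemma eqv_diff: "x \<approx> y \<Longrightarrow> x' \<approx> y' \<Longrightarrow> x - x' \<approx> y - y'"
  using diff_mem[of "x - y" "x' - y'"] by (simp add: eqv_def algebra_simps)

lemma eqv_lmult: "x \<approx> y \<Longrightarrow> a * x \<approx> a * y"
  using lmult_mem[of "x - y" a] by (simp add: eqv_def algebra_simps)

lemma eqv_sum: "(\<And>i. i \<in> A \<Longrightarrow> f i \<approx> g i) \<Longrightarrow> sum f A \<approx> sum g A"
  by (induction A rule: infinite_finite_induct) (auto intro: eqv_add)

lemma eqv_0_iff: "x \<approx> 0 \<longleftrightarrow> x \<in> L"
  by (simp add: eqv_def)

lemma eqv_mem: "x \<approx> y \<Longrightarrow> x \<in> L \<longleftrightarrow> y \<in> L"
  using eqv_trans eqv_sym eqv_0_iff by metis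

text \<open>The trailing \<open>w\<close> is built in because \<open>L\<close> is only a left ideal:
  congruences cannot be multiplied on the right, whereas the relations generate a two-sided
  ideal.\<close>

lemma eqv_commute:
  assumes "{i, j, k, l} \<subseteq> {1..m+n}"
  shows "gen i j * (gen k l * w) \<approx>
    (if odd_unit m i j \<and> odd_unit m k l then -1 else 1) * (gen k l * (gen i j * w))
    + ((if j = k then gen i l else 0)
       - (if odd_unit m i j \<and> odd_unit m k l then -1 else 1) * (if i = l then gen k j else 0)) * w"
proof -
  let ?s = "if odd_unit m i j \<and> odd_unit m k l then -1 else 1 :: free_alg"
  have "gen i j * gen k l - ?s * gen k l * gen i j
        - ((if j = k then gen i l else 0) - ?s * (if i = l then gen k j else 0))
      \<in> gl_relations m n"
    unfolding gl_relations_def using assms by blast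
  from two_sided_ideal.mult[OF this, of 1 w] show ?thesis
    unfolding eqv_def by (intro relations_mem) (simp add: algebra_simps mult.assoc)
qed

lemma eqv_add_mem: "x \<in> L \<Longrightarrow> x + y \<approx> y"
  by (simp add: eqv_def)

text \<open>The form used for raising operators: once \<open>gen i j\<close> kills \<open>w\<close>,
  only the bracket survives.\<close>

lemma eqv_commute_mem:
  assumes "{i, j, k, l} \<subseteq> {1..m+n}" "gen i j * w \<in> L"
  shows "gen i j * (gen k l * w) \<approx>
    ((if j = k then gen i l else 0)
       - (if odd_unit m i j \<and> odd_unit m k l then -1 else 1) * (if i = l then gen k j else 0)) * w"
  by (rule eqv_trans[OF eqv_commute eqv_add_mem]) (intro assms lmult_mem)+

end

text \<open>Signs are Booleans here, so that products of signs become exclusive or and are settled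
  by cases on parities.\<close>

definition sg :: "bool \<Rightarrow> free_alg \<Rightarrow> free_alg" where
  "sg b x = (if b then - x else x)"

lemma sg_simps [simp]:
  "sg b 0 = 0" "sg False x = x" "sg b (sg c x) = sg (b \<noteq> c) x"
  "sg b (- x) = - sg b x" "sg b (x + y) = sg b x + sg b y" "sg b (x - y) = sg b x - sg b y"
  "a * sg b x = sg b (a * x)"
  by (auto simp: sg_def)

section \<open>A module detecting the leading term\<close>

text \<open>
  The symbol \<open>(k, a, b)\<close> stands for the entry \<open>P\<^sub>a\<^sub>b\<close> of the projection \<open>P\<close> onto the \<open>k\<close>-th tautological
  subbundle of the flag supermanifold, along the span of the basis vectors with index \<open>> k\<close>; lists
  of symbols stand for products. The unit \<open>e\<^sub>i\<^sub>j\<close> acts as the superderivation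
  \<open>P\<^sub>a\<^sub>b \<mapsto> \<plusminus>(1 - P)\<^sub>a\<^sub>i P\<^sub>j\<^sub>b\<close>. Since these rules satisfy the relations of \<open>gl(m,n)\<close> without using
  supercommutativity of the entries, the free algebra on the symbols suffices, and \<open>gen_act\<close> is
  the transposed action, on functions of a list with values in a module.
\<close>

type_synonym sym = "nat \<times> nat \<times> nat"

fun gen_act :: "nat \<Rightarrow> nat \<Rightarrow> nat \<Rightarrow> (sym list \<Rightarrow> free_alg) \<Rightarrow> sym list \<Rightarrow> free_alg" where
  "gen_act m i j g [] = gen i j * g []"
| "gen_act m i j g ((k, a, b) # F) =
     (if a = i then g ((k, j, b) # F) else 0)
     - sg (odd_unit m i j \<and> odd_unit m a i) (g ((k, a, i) # (k, j, b) # F))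
     + sg (odd_unit m i j \<and> odd_unit m a b) (gen_act m i j (\<lambda>G. g ((k, a, b) # G)) F)"

lemma gen_act_add: "gen_act m i j (\<lambda>G. u G + v G) F = gen_act m i j u F + gen_act m i j v F"
proof (induction F arbitrary: u v)
  case (Cons s F)
  then show ?case by (cases s) simp
qed (simp add: distrib_left)

lemma gen_act_lmult_scal: "gen_act m i j (\<lambda>G. scal c * u G) F = scal c * gen_act m i j u F"
proof (induction F arbitrary: u)
  case Nil
  then show ?case by (simp add: scal_commute mult.assoc)
next
  case (Cons s F)
  then show ?case by (cases s) (simp add: algebra_simps)
qed

lemma gen_act_0: "gen_act m i j (\<lambda>G. 0) F = 0"
  using gen_act_lmult_scal[of m i j 0 "\<lambda>G. 0"] by simp

lemma gen_act_sg: "gen_act m i j (\<lambda>G. sg b (u G)) F = sg b (gen_act m i j u F)"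
  using gen_act_lmult_scal[of m i j "-1" u F] by (cases b) (simp_all add: sg_def scal_uminus)

lemma gen_act_uminus: "gen_act m i j (\<lambda>G. - u G) F = - gen_act m i j u F"
  using gen_act_sg[of m i j True] by (simp add: sg_def)

lemma gen_act_diff: "gen_act m i j (\<lambda>G. u G - v G) F = gen_act m i j u F - gen_act m i j v F"
  using gen_act_add[of m i j u "\<lambda>G. - v G"] by (simp add: gen_act_uminus)

lemma gen_act_if: "gen_act m i j (\<lambda>G. if P then u G else 0) F = (if P then gen_act m i j u F else 0)"
  by (simp add: gen_act_0)

lemmas gen_act_linear = gen_act_add gen_act_diff gen_act_sg gen_act_if

text \<open>Failure of \<open>gen_act\<close> to satisfy the supercommutator relation. On
  \<open>[]\<close> it is that relation times \<open>g []\<close>, which lies in every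
  \<open>L\<close> as above.\<close>

definition commutator_defect ::
  "nat \<Rightarrow> nat \<Rightarrow> nat \<Rightarrow> nat \<Rightarrow> nat \<Rightarrow> (sym list \<Rightarrow> free_alg) \<Rightarrow> sym list \<Rightarrow> free_alg" where
  "commutator_defect m i j k l g F =
     gen_act m i j (gen_act m k l g) F
     - sg (odd_unit m i j \<and> odd_unit m k l) (gen_act m k l (gen_act m i j g) F)
     - ((if j = k then gen_act m i l g F else 0)
        - sg (odd_unit m i j \<and> odd_unit m k l) (if i = l then gen_act m k j g F else 0))"

text \<open>The terms in which the first symbol is differentiated cancel identically, by cases on
  the parities of six indices. The remaining sign is the one for moving the bracket past that
  symbol.\<close>

lemma commutator_defect_Cons:
  "commutator_defect m i j k l g ((c, a, b) # F) =
     sg (odd_unit m a b \<and> (odd_unit m i j \<noteq> odd_unit m k l)) 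
       (commutator_defect m i j k l (\<lambda>G. g ((c, a, b) # G)) F)"
  by (cases "i \<le> m"; cases "j \<le> m"; cases "k \<le> m"; cases "l \<le> m"; cases "a \<le> m"; cases "b \<le> m";
    simp add: commutator_defect_def gen_act_linear odd_unit_def sg_def)

text \<open>Letters with an index out of range act by zero, in accordance with the relations that
  set them to zero.\<close>

definition letter_act :: "nat \<Rightarrow> nat \<Rightarrow> nat \<times> nat \<Rightarrow> (sym list \<Rightarrow> free_alg) \<Rightarrow> sym list \<Rightarrow> free_alg" where
  "letter_act m n = (\<lambda>(i, j) g F. if {i, j} \<subseteq> {1..m+n} then gen_act m i j g F else 0)"

lemma letter_act_add: "letter_act m n x (\<lambda>G. u G + v G) = (\<lambda>F. letter_act m n x u F + letter_act m n x v F)"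
  by (auto simp: letter_act_def gen_act_add split: prod.splits)

lemma letter_act_lmult_scal: "letter_act m n x (\<lambda>G. scal c * u G) = (\<lambda>F. scal c * letter_act m n x u F)"
  by (auto simp: letter_act_def gen_act_lmult_scal split: prod.splits)

definition word_act ::
  "nat \<Rightarrow> nat \<Rightarrow> word \<Rightarrow> (sym list \<Rightarrow> free_alg) \<Rightarrow> sym list \<Rightarrow> free_alg" where
  "word_act m n w = foldr (letter_act m n) (letters w)"

lemma word_act_0: "word_act m n 0 g = g"
  by (simp add: word_act_def zero_word_def)

lemma word_act_plus: "word_act m n (u + w) g = word_act m n u (word_act m n w g)"
  by (simp add: word_act_def plus_word_def)

lemma word_act_add: "word_act m n w (\<lambda>G. u G + v G) = (\<lambda>F. word_act m n w u F + word_act m n w v F)"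
proof (induction w)
  case (Word xs)
  show ?case by (induction xs) (simp_all add: word_act_def letter_act_add)
qed

lemma word_act_lmult_scal: "word_act m n w (\<lambda>G. scal c * u G) = (\<lambda>F. scal c * word_act m n w u F)"
proof (induction w)
  case (Word xs)
  show ?case by (induction xs) (simp_all add: word_act_def letter_act_lmult_scal)
qed

definition act ::
  "nat \<Rightarrow> nat \<Rightarrow> free_alg \<Rightarrow> (sym list \<Rightarrow> free_alg) \<Rightarrow> sym list \<Rightarrow> free_alg" where
  "act m n p g F = (\<Sum>w\<in>Poly_Mapping.keys p. scal (Poly_Mapping.lookup p w) * word_act m n w g F)"

lemma act_superset:
  assumes "finite A" "Poly_Mapping.keys p \<subseteq> A"
  shows "act m n p g F = (\<Sum>w\<in>A. scal (Poly_Mapping.lookup p w) * word_act m n w g F)"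
  unfolding act_def using assms
  by (intro sum.mono_neutral_left) (auto simp: in_keys_iff)

lemma act_single: "act m n (Poly_Mapping.single w c) g F = scal c * word_act m n w g F"
  by (subst act_superset[of "{w}"]) auto

lemma act_plus: "act m n (p + q) g F = act m n p g F + act m n q g F"
proof -
  let ?A = "Poly_Mapping.keys p \<union> Poly_Mapping.keys q"
  have "Poly_Mapping.keys (p + q) \<subseteq> ?A" by (rule Poly_Mapping.keys_add)
  then show ?thesis
    by (simp add: act_superset[of ?A] lookup_add scal_add distrib_right sum.distrib)
qed

lemma act_0: "act m n 0 g F = 0"
  by (simp add: act_def)

lemma act_uminus: "act m n (- p) g F = - act m n p g F"
  using act_plus[of m n p "- p" g F] by (simp add: act_0 eq_neg_iff_add_eq_0 add.commute)

lemma act_diff: "act m n (p - q) g F = act m n p g F - act m n q g F"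
  using act_plus[of m n p "- q" g F] by (simp add: act_uminus)

lemma act_sum: "act m n (sum f A) g F = (\<Sum>x\<in>A. act m n (f x) g F)"
  by (induction A rule: infinite_finite_induct) (simp_all add: act_0 act_plus)

lemma act_add_right: "act m n p (\<lambda>G. u G + v G) F = act m n p u F + act m n p v F"
  by (simp add: act_def word_act_add distrib_left sum.distrib)

text \<open>So \<open>act\<close> is a left module structure on the functions of symbol
  lists.\<close>

lemma act_mult: "act m n (p * q) g F = act m n p (act m n q g) F"
proof (induction q rule: free_alg_induct)
  case (single w c)
  show ?case
  proof (induction p rule: free_alg_induct)
    case (single u d)
    have "act m n (Poly_Mapping.single w c) g = (\<lambda>F. scal c * word_act m n w g F)"
      by (rule ext) (rule act_single)
    then show ?case
      by (simp add: mult_single act_single word_act_plus word_act_lmult_scal scal_mult mult.assoc)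
  next
    case (add p p')
    then show ?case by (simp add: distrib_right act_plus)
  qed
next
  case (add q q')
  have "act m n (q + q') g = (\<lambda>G. act m n q g G + act m n q' g G)"
    by (rule ext) (rule act_plus)
  with add show ?case by (simp add: distrib_left act_plus act_add_right)
qed

lemma act_scal: "act m n (scal c) g F = scal c * g F"
  using act_single[of m n 0 c g F] by (simp add: word_act_0 flip: scal_def)

lemma act_1: "act m n 1 g = g"
  using act_scal[of m n 1 g] by auto

lemma act_gen: "act m n (gen i j) g = letter_act m n (i, j) g"
  by (rule ext) (simp add: gen_def act_single word_act_def)

context gl_left_ideal
begin

lemma sg_mem: "x \<in> L \<Longrightarrow> sg b x \<in> L"
  by (simp add: sg_def uminus_mem)

lemma gen_act_mem: "(\<And>F. g F \<in> L) \<Longrightarrow> gen_act m i j g F \<in> L"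
proof (induction F arbitrary: g)
  case Nil
  then show ?case by (simp add: lmult_mem)
next
  case (Cons s F)
  then show ?case by (cases s) (auto intro!: add_mem diff_mem sg_mem zero_mem)
qed

lemma letter_act_mem: "(\<And>F. g F \<in> L) \<Longrightarrow> letter_act m n x g F \<in> L"
  by (cases x) (simp add: letter_act_def gen_act_mem zero_mem)

lemma word_act_mem: "(\<And>F. g F \<in> L) \<Longrightarrow> word_act m n w g F \<in> L"
proof (induction w)
  case (Word xs)
  then show ?case by (induction xs arbitrary: F) (auto simp: word_act_def letter_act_mem)
qed

lemma act_mem: "(\<And>F. g F \<in> L) \<Longrightarrow> act m n p g F \<in> L"
  unfolding act_def by (intro sum_mem lmult_mem word_act_mem)

lemma commutator_defect_mem: "{i, j, k, l} \<subseteq> {1..m+n} \<Longrightarrow> commutator_defect m i j k l g F \<in> L"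
proof (induction F arbitrary: g)
  case Nil
  then show ?case
    using eqv_commute[of i j k l "g []"]
    by (auto simp: commutator_defect_def eqv_def sg_def algebra_simps mult.assoc)
next
  case (Cons s F)
  then show ?case by (cases s) (simp add: commutator_defect_Cons sg_mem)
qed

lemma act_relation_mem:
  assumes "r \<in> gl_relations m n"
  shows "act m n r g F \<in> L"
proof -
  from assms consider i j k l where "{i, j, k, l} \<subseteq> {1..m+n}"
      "r = gen i j * gen k l
        - (if odd_unit m i j \<and> odd_unit m k l then -1 else 1) * gen k l * gen i j
        - ((if j = k then gen i l else 0)
           - (if odd_unit m i j \<and> odd_unit m k l then -1 else 1) * (if i = l then gen k j else 0))"
    | i j where "\<not> {i, j} \<subseteq> {1..m+n}" "r = gen i j"
    unfolding gl_relations_def by blast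
  then show ?thesis
  proof cases
    case 1
    have letter_act: "letter_act m n (a, b) = gen_act m a b" if "{a, b} \<subseteq> {i, j, k, l}" for a b
      using 1(1) that by (intro ext) (auto simp: letter_act_def)
    have "act m n r g F = commutator_defect m i j k l g F"
      unfolding 1(2)
      by (cases "odd_unit m i j \<and> odd_unit m k l"; cases "j = k"; cases "i = l")
        (auto simp: commutator_defect_def sg_def act_diff act_plus act_mult act_gen act_uminus act_0 act_1 letter_act)
    with 1 show ?thesis by (simp add: commutator_defect_mem)
  next
    case 2
    then show ?thesis by (auto simp: act_gen letter_act_def zero_mem)
  qed
qed

text \<open>Together with \<open>act_mem\<close>, this makes the functions with values in the free
  algebra modulo \<open>L\<close> a module over U(gl(m,n)).\<close>

lemma act_ideal_mem: "x \<in> two_sided_ideal (gl_relations m n) \<Longrightarrow> act m n x g F \<in> L"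
proof (induction arbitrary: g F rule: two_sided_ideal.induct)
  case zero
  then show ?case by (simp add: act_0 zero_mem)
next
  case (mult s a b)
  then show ?case by (simp add: act_mult act_mem act_relation_mem)
next
  case (add x y)
  then show ?case by (simp add: act_plus add_mem)
qed

end

section \<open>Evaluation at the base point and orders of vanishing\<close>

fun diag_sym :: "sym \<Rightarrow> bool" where
  "diag_sym (k, a, b) \<longleftrightarrow> a = b \<and> a \<le> k"

text \<open>\<open>ev\<close> evaluates at the base point of the flag supermanifold, where \<open>P\<^sub>a\<^sub>b\<close> is \<open>1\<close> iff \<open>a = b \<le> k\<close>.\<close>

definition ev :: "sym list \<Rightarrow> free_alg" where
  "ev F = (if list_all diag_sym F then 1 else 0)"

lemma ev_Cons: "ev (s # F) = (if diag_sym s then ev F else 0)"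
  by (simp add: ev_def)

text \<open>Upper triangular matrices fix the base point: in the derivative of a symbol at level k,
  nonzero values of (1 - P)_ai and P_jb would force i > k \<ge> j. Only the action on the
  coefficients remains.\<close>

lemma gen_act_ev_upper:
  assumes "i \<le> j"
  shows "gen_act m i j ev F = ev F * gen i j"
proof (induction F)
  case Nil
  then show ?case by (simp add: ev_def)
next
  case (Cons s F)
  obtain k a b where s: "s = (k, a, b)" by (cases s)
  have *: "(\<lambda>G. ev ((k, a, b) # G)) = (\<lambda>G. if a = b \<and> a \<le> k then ev G else 0)"
    by (simp add: ev_Cons)
  have "gen_act m i j ev (s # F) = sg (odd_unit m i j \<and> odd_unit m a b)
      (if a = b \<and> a \<le> k then gen_act m i j ev F else 0)"
    unfolding s gen_act.simps * gen_act_if using assms by (auto simp: ev_Cons odd_unit_def sg_def)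
  also have "\<dots> = ev (s # F) * gen i j"
    using Cons by (auto simp: s ev_Cons odd_unit_def)
  finally show ?case .
qed

text \<open>
  \<open>off_diag\<close> is the order of vanishing at the base point. A derivation lowers it by at most one, so
  only the longest monomial \<open>f_elt {1..m+n}\<close> can reach the value of \<open>ev\<close> from \<open>yword (m + n - 1)\<close>.
\<close>

definition off_diag :: "sym list \<Rightarrow> nat" where
  "off_diag F = length (filter (\<lambda>s. \<not> diag_sym s) F)"

lemma off_diag_simps [simp]:
  "off_diag [] = 0" "off_diag (s # F) = (if diag_sym s then 0 else 1) + off_diag F"
  "off_diag (F @ G) = off_diag F + off_diag G"
  by (simp_all add: off_diag_def)

text \<open>A derivation turns a symbol into one symbol or a pair of symbols, so at most one
  off-diagonal symbol is lost. The offset \<open>c\<close> counts those already moved from the list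
  into \<open>g\<close>.\<close>

lemma gen_act_eq_0:
  assumes "\<And>G. r \<le> c + off_diag G \<Longrightarrow> g G = 0" and "Suc r \<le> c + off_diag F"
  shows "gen_act m i j g F = 0"
  using assms
proof (induction F arbitrary: c g)
  case Nil
  then show ?case by simp
next
  case (Cons s F)
  obtain k a b where s: "s = (k, a, b)" by (cases s)
  have "gen_act m i j (\<lambda>G. g (s # G)) F = 0"
    using Cons.prems by (intro Cons.IH[of "c + off_diag [s]"]) auto
  moreover have "g ((k, j, b) # F) = 0" "g ((k, a, i) # (k, j, b) # F) = 0"
    using Cons.prems by (auto split: if_splits)
  ultimately show ?case by (simp add: s)
qed

text \<open>As i and j are distinct, differentiating a diagonal symbol creates an off-diagonal one,
  and then \<open>g\<close> vanishes. To leading order diagonal symbols are constants.\<close>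

lemma gen_act_diag_append:
  assumes "i \<noteq> j" "\<And>G. r \<le> off_diag G \<Longrightarrow> g G = 0" "r \<le> Suc (off_diag F)" "list_all diag_sym ds"
  shows "gen_act m i j g (ds @ F) = gen_act m i j (\<lambda>G. g (ds @ G)) F"
  using assms(2,4)
proof (induction ds arbitrary: g)
  case Nil
  then show ?case by simp
next
  case (Cons s ds)
  obtain k a where s: "s = (k, a, a)" "a \<le> k"
    using Cons.prems(2) by (cases s) auto
  have "g ((k, j, a) # ds @ F) = 0" if "a = i"
    using that assms Cons.prems s by (intro Cons.prems(1)) auto
  moreover have "g ((k, a, i) # (k, j, a) # ds @ F) = 0"
    using assms Cons.prems s by (intro Cons.prems(1)) auto
  ultimately have "gen_act m i j g ((s # ds) @ F) = gen_act m i j (\<lambda>G. g (s # G)) (ds @ F)"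
    by (simp add: s odd_unit_def)
  also have "\<dots> = gen_act m i j (\<lambda>G. g (s # ds @ G)) F"
    using Cons.prems s by (subst Cons.IH) auto
  finally show ?case by simp
qed

text \<open>The coordinate near the base point whose derivative by \<open>gen (k + 1) k\<close> is
  (1 - P)_(k+1,k+1) P_kk, of value 1 there.\<close>

definition ysym :: "nat \<Rightarrow> sym" where
  "ysym k = (k, k + 1, k)"

definition yword :: "nat \<Rightarrow> sym list" where
  "yword p = map ysym (rev [1..<p + 1])"

lemma yword_Suc: "yword (Suc p) = ysym (Suc p) # yword p" and yword_0: "yword 0 = []"
  by (simp_all add: yword_def)

lemma off_diag_yword: "off_diag (yword p) = p"
  by (induction p) (simp_all add: yword_Suc yword_0 ysym_def)

text \<open>For r \<le> q < p the derivation by \<open>gen (p + 1) p\<close> replaces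
  \<open>ysym r\<close> by two off-diagonal symbols, which raises the order of vanishing instead of
  lowering it.\<close>

lemma gen_act_yword_0:
  assumes "\<And>G. q \<le> off_diag G \<Longrightarrow> g G = 0" "q < p"
  shows "gen_act m (p + 1) p g (yword q) = 0"
  using assms
proof (induction q arbitrary: g)
  case 0
  then show ?case by (simp add: yword_0)
next
  case (Suc q)
  have "g ((Suc q, Suc (Suc q), p + 1) # (Suc q, p, Suc q) # yword q) = 0"
    using Suc.prems by (intro Suc.prems) (auto simp: off_diag_yword)
  moreover have "gen_act m (p + 1) p (\<lambda>G. g (ysym (Suc q) # G)) (yword q) = 0"
    using Suc.prems by (intro Suc.IH) (auto simp: ysym_def)
  ultimately show ?case
    using Suc.prems by (simp add: yword_Suc) (simp add: ysym_def)
qed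

text \<open>The full chain monomial applied to \<open>ev\<close>, see
  \<open>word_act_chain_full\<close>.\<close>

primrec lowering_ev :: "nat \<Rightarrow> nat \<Rightarrow> sym list \<Rightarrow> free_alg" where
  "lowering_ev m 0 = ev"
| "lowering_ev m (Suc p) = gen_act m (Suc p + 1) (Suc p) (lowering_ev m p)"

lemma ev_eq_0: "off_diag G \<noteq> 0 \<Longrightarrow> ev G = 0"
  by (induction G) (auto simp: ev_Cons)

lemma lowering_ev_eq_0: "p < off_diag G \<Longrightarrow> lowering_ev m p G = 0"
proof (induction p arbitrary: G)
  case 0
  then show ?case by (simp add: ev_eq_0)
next
  case (Suc p)
  have "gen_act m (Suc p + 1) (Suc p) (lowering_ev m p) G = 0"
    using Suc by (intro gen_act_eq_0[of "Suc p" 0]) auto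
  then show ?case by simp
qed

text \<open>Only the derivative of \<open>ysym p\<close> by \<open>gen (p + 1) p\<close> lowers the
  order. It leaves the diagonal symbol (p, p, p) behind, which is why an arbitrary diagonal prefix
  \<open>ds\<close> is carried along.\<close>

lemma lowering_ev_yword: "list_all diag_sym ds \<Longrightarrow> lowering_ev m p (ds @ yword p) = 1"
proof (induction p arbitrary: ds)
  case 0
  then show ?case by (simp add: yword_0 ev_def)
next
  case (Suc p)
  let ?g = "\<lambda>G. lowering_ev m p (ds @ G)" and ?q = "Suc p"
  have ds: "off_diag ds = 0"
    using Suc.prems by (induction ds) auto
  have "lowering_ev m ?q (ds @ yword ?q) = gen_act m (?q + 1) ?q ?g (yword ?q)"
    unfolding lowering_ev.simps using Suc.prems
    by (intro gen_act_diag_append[where r = ?q]) (auto simp: lowering_ev_eq_0 off_diag_yword)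
  also have "\<dots> = ?g ((?q, ?q, ?q) # yword p)"
  proof -
    \<comment> \<open>The symbol at (q + 1, q + 1) is off-diagonal because q + 1 exceeds the level
      q, so the order is still too high.\<close>
    have "?g ((?q, ?q + 1, ?q + 1) # (?q, ?q, ?q) # yword p) = 0"
      by (rule lowering_ev_eq_0) (simp add: off_diag_yword)
    moreover have "gen_act m (?q + 1) ?q (\<lambda>G. ?g (ysym ?q # G)) (yword p) = 0"
      by (rule gen_act_yword_0) (auto intro!: lowering_ev_eq_0 simp: ysym_def)
    ultimately show ?thesis
      unfolding yword_Suc by (simp add: ysym_def)
  qed
  also have "\<dots> = 1"
    using Suc.IH[of "ds @ [(?q, ?q, ?q)]"] Suc.prems by simp
  finally show ?case .
qed

lemma gl_left_ideal_verma: "gl_left_ideal m n (verma_ideal m n lam)"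
  unfolding verma_ideal_def
  by unfold_locales (auto intro: left_ideal.add left_ideal_lmult left_ideal_base)

text \<open>By \<open>gen_act_ev_upper\<close> the generators \<open>s\<close> of the ideal other
  than relations act on \<open>ev\<close> by \<open>ev F * s\<close>, so modulo the ideal
  \<open>ev\<close> satisfies the conditions on a highest weight vector of weight
  \<open>lam\<close>. Hence x \<mapsto> \<open>act m n x ev\<close> factors through M(lam).\<close>

lemma act_ev_verma_ideal:
  assumes "x \<in> verma_ideal m n lam"
  shows "act m n x ev F \<in> verma_ideal m n lam"
proof -
  interpret gl_left_ideal m n "verma_ideal m n lam" by (rule gl_left_ideal_verma)
  have gens: "s \<in> n_plus m n \<union> {gen i i - scal (lam i) | i. i \<in> {1..m+n}} \<Longrightarrow> s \<in> verma_ideal m n lam"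
    for s unfolding verma_ideal_def by (rule left_ideal_base) blast
  from assms[unfolded verma_ideal_def] show ?thesis
  proof (induction arbitrary: F rule: left_ideal.induct)
    case zero
    then show ?case by (simp add: act_0 zero_mem)
  next
    case (mult s a)
    have "act m n s ev F \<in> verma_ideal m n lam" for F
    proof -
      from mult consider "s \<in> two_sided_ideal (gl_relations m n)"
        | i j where "s = gen i j" "1 \<le> i" "i < j" "j \<le> m + n" "s \<in> verma_ideal m n lam"
        | i where "s = gen i i - scal (lam i)" "i \<in> {1..m+n}" "s \<in> verma_ideal m n lam"
        using gens unfolding n_plus_def by blast
      then show ?thesis
      proof cases
        case 1
        then show ?thesis by (rule act_ideal_mem)
      next
        case 2
        then have "act m n s ev F = ev F * s"
          by (simp add: act_gen letter_act_def gen_act_ev_upper)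
        with 2 show ?thesis by (simp add: lmult_mem)
      next
        case 3
        then have "act m n s ev F = ev F * s"
          by (simp add: act_diff act_gen act_scal letter_act_def gen_act_ev_upper scal_commute right_diff_distrib)
        with 3 show ?thesis by (simp add: lmult_mem)
      qed
    qed
    then show ?case by (simp add: act_mult act_mem)
  next
    case (add x y)
    then show ?case by (simp add: act_plus add_mem)
  qed
qed

section \<open>Nonvanishing through the leading monomial\<close>

lemma prod_list_gen: "prod_list (map (\<lambda>(i, j). gen i j) xs) = Poly_Mapping.single (Word xs) 1"
proof (induction xs)
  case Nil
  show ?case by (simp flip: zero_word_def)
next
  case (Cons x xs)
  then show ?case by (cases x) (simp add: gen_def mult_single plus_word_def)
qed

definition chain :: "nat set \<Rightarrow> (nat \<times> nat) list" where
  "chain I = (let is = rev (sorted_list_of_set I) in zip is (tl is))"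

lemma f_elt_chain: "f_elt I = Poly_Mapping.single (Word (chain I)) 1"
  by (simp add: f_elt_def chain_def Let_def prod_list_gen)

lemma length_chain: "length (chain I) = card I - 1"
  by (simp add: chain_def Let_def)

lemma chain_full: "chain {1..Suc p} = map (\<lambda>k. (k + 1, k)) (rev [1..<Suc p])"
proof -
  have "sorted_list_of_set {1..Suc p} = [1..<Suc (Suc p)]"
    by (metis atLeastLessThanSuc_atLeastAtMost sorted_list_of_set_range)
  then have "chain {1..Suc p} = zip (rev [1..<Suc (Suc p)]) (tl (rev [1..<Suc (Suc p)]))"
    by (simp add: chain_def Let_def del: upt_Suc)
  also have "\<dots> = map (\<lambda>k. (k + 1, k)) (rev [1..<Suc p])"
    by (rule nth_equalityI) (simp_all add: nth_tl rev_nth del: upt_Suc)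
  finally show ?thesis .
qed

lemma word_act_chain_full: "Suc p \<le> m + n \<Longrightarrow> word_act m n (Word (chain {1..Suc p})) ev = lowering_ev m p"
proof (induction p)
  case 0
  then show ?case using chain_full[of 0] by (simp add: word_act_def)
next
  case (Suc p)
  have "chain {1..Suc (Suc p)} = (Suc p + 1, Suc p) # chain {1..Suc p}"
    unfolding chain_full by simp
  then show ?case
    using Suc by (simp add: word_act_def) (intro ext, simp add: letter_act_def)
qed

lemma word_act_ev_eq_0: "length xs < off_diag F \<Longrightarrow> word_act m n (Word xs) ev F = 0"
proof (induction xs arbitrary: F)
  case Nil
  then show ?case by (simp add: word_act_def ev_eq_0)
next
  case (Cons x xs)
  obtain i j where x: "x = (i, j)" by (cases x)
  have "gen_act m i j (word_act m n (Word xs) ev) F = 0"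
    using Cons by (intro gen_act_eq_0[of "Suc (length xs)" 0]) auto
  then show ?case by (simp add: word_act_def letter_act_def x)
qed

lemma finite_index_sets: "finite (index_sets m n)"
  unfolding index_sets_def by (rule finite_subset[of _ "Pow {1..m+n}"]) auto

text \<open>A fragment of the PBW theorem. Every term but the one for \<open>{1..m+n}\<close> has a
  chain shorter than the order of vanishing m + n - 1 of the test word.\<close>

lemma f_elt_combination_notin_verma_ideal:
  assumes "1 \<le> m + n" and "c {1..m+n} = 1" and "1 \<notin> verma_ideal m n lam"
  shows "(\<Sum>J\<in>index_sets m n. f_elt J * scal (c J)) \<notin> verma_ideal m n lam"
proof
  let ?F = "yword (m + n - 1)"
  assume "(\<Sum>J\<in>index_sets m n. f_elt J * scal (c J)) \<in> verma_ideal m n lam"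
  from act_ev_verma_ideal[OF this, of ?F]
  have "(\<Sum>J\<in>index_sets m n. scal (c J) * word_act m n (Word (chain J)) ev ?F) \<in> verma_ideal m n lam"
    by (simp add: act_sum act_mult act_scal act_single f_elt_chain flip: scal_commute)
  also have "(\<Sum>J\<in>index_sets m n. scal (c J) * word_act m n (Word (chain J)) ev ?F)
      = (\<Sum>J\<in>{{1..m+n}}. scal (c J) * word_act m n (Word (chain J)) ev ?F)"
  proof (intro sum.mono_neutral_right ballI)
    show "{{1..m+n}} \<subseteq> index_sets m n"
      using assms(1) by (auto simp: index_sets_def)
  next
    fix J assume J: "J \<in> index_sets m n - {{1..m+n}}"
    then have "J \<subset> {1..m+n}" "1 \<in> J" by (auto simp: index_sets_def)
    then have "card J < m + n" "0 < card J"
      using psubset_card_mono[of "{1..m+n}" J] by (auto simp: card_gt_0_iff finite_subset)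
    then have "length (chain J) < off_diag ?F"
      by (simp add: length_chain off_diag_yword)
    then show "scal (c J) * word_act m n (Word (chain J)) ev ?F = 0"
      by (simp add: word_act_ev_eq_0)
  qed (rule finite_index_sets)
  also have "\<dots> = 1"
  proof -
    have "Suc (m + n - 1) = m + n" using assms(1) by simp
    then show ?thesis
      using assms(2) word_act_chain_full[of "m + n - 1" m n] lowering_ev_yword[of "[]" m "m + n - 1"]
      by simp
  qed
  finally show False using assms(3) by simp
qed

section \<open>Raising operators applied to \<open>Theta\<close>\<close>

definition has_wt :: "nat \<Rightarrow> nat \<Rightarrow> free_alg \<Rightarrow> weight \<Rightarrow> bool" where
  "has_wt m n x \<mu> \<longleftrightarrow> (\<forall>i\<in>{1..m+n}.
     gen i i * x - x * gen i i - scal (\<mu> i) * x \<in> two_sided_ideal (gl_relations m n))"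

lemma has_wt_mult:
  assumes "has_wt m n x \<mu>" "has_wt m n y \<nu>"
  shows "has_wt m n (x * y) (\<lambda>i. \<mu> i + \<nu> i)"
  unfolding has_wt_def
proof
  fix i assume i: "i \<in> {1..m+n}"
  have "gen i i * (x * y) - x * y * gen i i - scal (\<mu> i + \<nu> i) * (x * y)
      = (gen i i * x - x * gen i i - scal (\<mu> i) * x) * y
        + x * (gen i i * y - y * gen i i - scal (\<nu> i) * y)"
    using scal_commute[of "\<nu> i" x] by (simp add: algebra_simps scal_add flip: mult.assoc)
  also have "\<dots> \<in> two_sided_ideal (gl_relations m n)"
    using assms i
    by (intro two_sided_ideal.add two_sided_ideal_rmult[of _ _ y] two_sided_ideal_lmult[of _ _ x])
      (auto simp: has_wt_def)
  finally show "gen i i * (x * y) - x * y * gen i i - scal (\<mu> i + \<nu> i) * (x * y)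
    \<in> two_sided_ideal (gl_relations m n)" .
qed

lemma has_wt_add:
  assumes "has_wt m n x \<mu>" "has_wt m n y \<mu>"
  shows "has_wt m n (x + y) \<mu>"
  unfolding has_wt_def
proof
  fix i assume i: "i \<in> {1..m+n}"
  have "gen i i * (x + y) - (x + y) * gen i i - scal (\<mu> i) * (x + y)
      = (gen i i * x - x * gen i i - scal (\<mu> i) * x) + (gen i i * y - y * gen i i - scal (\<mu> i) * y)"
    by (simp add: algebra_simps)
  with assms i show "gen i i * (x + y) - (x + y) * gen i i - scal (\<mu> i) * (x + y)
    \<in> two_sided_ideal (gl_relations m n)"
    by (auto simp: has_wt_def intro: two_sided_ideal.add)
qed

lemma has_wt_0: "has_wt m n 0 \<mu>"
  by (simp add: has_wt_def two_sided_ideal.zero)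

lemma has_wt_sum: "(\<And>i. i \<in> A \<Longrightarrow> has_wt m n (f i) \<mu>) \<Longrightarrow> has_wt m n (sum f A) \<mu>"
  by (induction A rule: infinite_finite_induct) (auto simp: has_wt_0 has_wt_add)

lemma has_wt_scal: "has_wt m n (scal c) (\<lambda>_. 0)"
  by (simp add: has_wt_def two_sided_ideal.zero flip: scal_commute)

lemma has_wt_gen:
  assumes "k \<in> {1..m+n}" "l \<in> {1..m+n}"
  shows "has_wt m n (gen k l) (root_weight (k, l))"
  unfolding has_wt_def
proof
  fix i assume i: "i \<in> {1..m+n}"
  have "gen i i * gen k l
        - (if odd_unit m i i \<and> odd_unit m k l then -1 else 1) * gen k l * gen i i
        - ((if i = k then gen i l else 0)
           - (if odd_unit m i i \<and> odd_unit m k l then -1 else 1) * (if i = l then gen k i else 0))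
        \<in> gl_relations m n"
    unfolding gl_relations_def using i assms by blast
  from two_sided_ideal_base[OF this]
  show "gen i i * gen k l - gen k l * gen i i - scal (root_weight (k, l) i) * gen k l
      \<in> two_sided_ideal (gl_relations m n)"
    by (auto simp: odd_unit_def root_weight_def dual_def scal_diff scal_uminus)
qed

lemma has_wt_subalg_h_gens: "h \<in> subalg (h_gens m n) \<Longrightarrow> has_wt m n h (\<lambda>_. 0)"
proof (induction rule: subalg.induct)
  case (scal c)
  show ?case by (rule has_wt_scal)
next
  case (base s)
  then show ?case
    using has_wt_gen by (fastforce simp: h_gens_def root_weight_def)
next
  case (add x y)
  then show ?case by (simp add: has_wt_add)
next
  case (mult x y)
  then show ?case using has_wt_mult[of m n x "\<lambda>_. 0" y "\<lambda>_. 0"] by simp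
qed

lemma subalg_sum: "(\<And>i. i \<in> A \<Longrightarrow> f i \<in> subalg S) \<Longrightarrow> sum f A \<in> subalg S"
  using subalg.scal[of 0 S]
  by (induction A rule: infinite_finite_induct) (auto intro: subalg.add)

lemma subalg_prod_list: "set xs \<subseteq> subalg S \<Longrightarrow> prod_list xs \<in> subalg S"
  using subalg.scal[of 1 S] by (induction xs) (auto intro: subalg.mult)

lemma subalg_mono: "S \<subseteq> S' \<Longrightarrow> x \<in> subalg S \<Longrightarrow> x \<in> subalg S'"
  by (rotate_tac 1, erule subalg.induct) (auto intro: subalg.intros)

lemma h_of_subalg: "h_of m n a \<in> subalg (h_gens m n)"
  unfolding h_of_def
  by (intro subalg_sum subalg.mult subalg.scal subalg.base) (auto simp: h_gens_def)

lemma h_elt_subalg: "h_elt m n i \<in> subalg (h_gens m n)"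
  by (auto simp: h_elt_def intro!: subalg.add subalg.scal h_of_subalg)

text \<open>The coefficient \<open>A\<^sub>b\<^sub>k\<close>: the part of \<open>H_elt\<close>
  contributed by the gap between neighbours b < k of a chain. The shift to \<open>x - 1\<close> is
  that of \<open>r_set\<close>.\<close>

definition h_between :: "nat \<Rightarrow> nat \<Rightarrow> nat \<Rightarrow> nat \<Rightarrow> free_alg" where
  "h_between m n b k = prod_list (map (\<lambda>x. h_elt m n (x - 1)) [b + 1..<k])"

lemma h_between_subalg: "h_between m n b k \<in> subalg (h_gens m n)"
  unfolding h_between_def by (rule subalg_prod_list) (auto simp: h_elt_subalg)

lemma h_between_Suc: "b < p \<Longrightarrow> h_between m n b (p + 1) = h_between m n b p * h_elt m n (p - 1)"
  by (simp add: h_between_def)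

lemma h_between_self: "h_between m n p (p + 1) = 1"
  by (simp add: h_between_def)

lemma h_between_step: "p + 1 < k \<Longrightarrow> h_between m n p k = h_elt m n p * h_between m n (p + 1) k"
  by (simp add: h_between_def upt_conv_Cons)

text \<open>\<open>theta_upto m n k\<close> collects the terms of \<open>Theta\<close> for chains from \<open>k\<close> down to \<open>1\<close>.\<close>

fun theta_upto :: "nat \<Rightarrow> nat \<Rightarrow> nat \<Rightarrow> free_alg" where
  "theta_upto m n k = (if k \<le> 1 then 1 else
     (\<Sum>b\<in>{1..<k}. gen k b * (theta_upto m n b * h_between m n b k)))"

declare theta_upto.simps [simp del]

lemma theta_upto_1: "theta_upto m n (Suc 0) = 1"
  by (simp add: theta_upto.simps)

lemma theta_upto_rec:
  "2 \<le> k \<Longrightarrow> theta_upto m n k = (\<Sum>b\<in>{1..<k}. gen k b * (theta_upto m n b * h_between m n b k))"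
  by (subst theta_upto.simps) simp

lemma has_wt_theta_upto:
  assumes "1 \<le> k" "k \<le> m + n"
  shows "has_wt m n (theta_upto m n k) (root_weight (k, 1))"
  using assms
proof (induction k rule: less_induct)
  case (less k)
  show ?case
  proof (cases "k = 1")
    case True
    then show ?thesis using has_wt_scal[of m n 1] by (simp add: theta_upto_1 root_weight_def)
  next
    case False
    have "has_wt m n (gen k b * (theta_upto m n b * h_between m n b k)) (root_weight (k, 1))"
      if b: "b \<in> {1..<k}" for b
    proof -
      have 1: "has_wt m n (theta_upto m n b) (root_weight (b, 1))"
        using less b by auto
      have "has_wt m n (gen k b * (theta_upto m n b * h_between m n b k))
        (\<lambda>i. root_weight (k, b) i + (root_weight (b, 1) i + 0))"
        using b less.prems
        by (intro has_wt_mult 1 has_wt_gen has_wt_subalg_h_gens h_between_subalg) auto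
      then show ?thesis by (simp add: root_weight_def)
    qed
    with False less.prems show ?thesis
      by (subst theta_upto_rec) (auto intro: has_wt_sum)
  qed
qed

text \<open>
  \<open>raised_factor m n p\<close> is the right factor in \<open>e\<^sub>p\<^sub>,\<^sub>p\<^sub>+\<^sub>1 theta_upto (p + 1) = theta_upto p * _\<close>. For
  \<open>p \<noteq> m\<close> it equals \<open>h_elt m n p\<close>, for \<open>p = m\<close> it is \<open>zeta m n - h_elt m n m\<close>.
\<close>

definition raised_factor :: "nat \<Rightarrow> nat \<Rightarrow> nat \<Rightarrow> free_alg" where
  "raised_factor m n p = gen p p - (if p = m then -1 else 1) * gen (p + 1) (p + 1)
     + (if 1 < p then 1 + h_elt m n (p - 1) else 0)"

text \<open>Stability under right multiplication by diagonal units is required because the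
  coefficients from U(h) stand to the right of the lowering monomials.\<close>

locale raising = gl_left_ideal +
  assumes n_plus_mem: "x \<in> n_plus m n \<Longrightarrow> x \<in> L"
    and rmult_gen_mem: "x \<in> L \<Longrightarrow> i \<in> {1..m+n} \<Longrightarrow> x * gen i i \<in> L"
begin

lemma rmult_mem: "h \<in> subalg (h_gens m n) \<Longrightarrow> x \<in> L \<Longrightarrow> x * h \<in> L"
proof (induction arbitrary: x rule: subalg.induct)
  case (scal c)
  then show ?case by (simp add: lmult_mem flip: scal_commute)
next
  case (base s)
  then show ?case by (auto simp: h_gens_def rmult_gen_mem)
next
  case (add y z)
  then show ?case by (simp add: distrib_left add_mem)
next
  case (mult y z)
  then show ?case by (simp flip: mult.assoc)
qed

text \<open>The bracket with \<open>gen k b\<close> vanishes, as b < k \<le> p, so the raising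
  operator passes down to \<open>theta_upto m n 1\<close>, which is 1.\<close>

lemma raise_above:
  assumes "1 \<le> k" "k \<le> p" "p + 1 \<le> m + n"
  shows "gen p (p + 1) * theta_upto m n k \<in> L"
  using assms
proof (induction k rule: less_induct)
  case (less k)
  show ?case
  proof (cases "k = 1")
    case True
    with less.prems have "gen p (p + 1) \<in> n_plus m n" by (auto simp: n_plus_def)
    with True show ?thesis by (simp add: theta_upto_1 n_plus_mem)
  next
    case False
    have "gen p (p + 1) * (gen k b * (theta_upto m n b * h_between m n b k)) \<in> L"
      if b: "b \<in> {1..<k}" for b
    proof -
      let ?w = "theta_upto m n b * h_between m n b k"
      have "gen p (p + 1) * theta_upto m n b * h_between m n b k \<in> L"
        using less b by (intro rmult_mem[OF h_between_subalg]) auto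
      then have "gen p (p + 1) * ?w \<in> L"
        by (simp add: mult.assoc)
      from eqv_commute_mem[OF _ this, of k b] show ?thesis
        using b less.prems by (auto simp: eqv_0_iff)
    qed
    with False less.prems show ?thesis
      by (subst theta_upto_rec) (auto simp: sum_distrib_left intro: sum_mem)
  qed
qed

text \<open>For b < p the bracket is \<open>gen p b\<close>; as \<open>?A b (p + 1)\<close> is
  \<open>?A b p\<close> times \<open>h_elt m n (p - 1)\<close>, these terms add up to
  \<open>?T p * h_elt m n (p - 1)\<close>. For b = p the bracket is diagonal.\<close>

lemma raise_equal:
  assumes p: "1 \<le> p" "p + 1 \<le> m + n"
  shows "gen p (p + 1) * theta_upto m n (p + 1) \<approx> theta_upto m n p * raised_factor m n p"
proof -
  let ?T = "theta_upto m n" and ?A = "h_between m n" and ?e = "gen p (p + 1)"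
  let ?s = "if p = m then -1 else 1 :: free_alg"
  have below: "?e * (gen (p + 1) b * (?T b * ?A b (p + 1))) \<approx> gen p b * (?T b * ?A b (p + 1))"
    if b: "b \<in> {1..<p}" for b
  proof -
    let ?w = "?T b * ?A b (p + 1)"
    have "?e * ?T b * ?A b (p + 1) \<in> L"
      using p b by (intro rmult_mem[OF h_between_subalg] raise_above) auto
    then have "?e * ?w \<in> L"
      by (simp add: mult.assoc)
    from eqv_commute_mem[OF _ this, of "p + 1" b] show ?thesis
      using p b by auto
  qed
  have "?e * (gen (p + 1) p * ?T p) \<approx> (gen p p - ?s * gen (p + 1) (p + 1)) * ?T p"
  proof -
    have "?e * ?T p \<in> L" using p by (intro raise_above) auto
    moreover have "odd_unit m p (p + 1) \<longleftrightarrow> p = m" "odd_unit m (p + 1) p \<longleftrightarrow> p = m"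
      by (auto simp: odd_unit_def)
    ultimately show ?thesis
      using eqv_commute_mem[of p "p + 1" "p + 1" p "?T p"] p by auto
  qed
  \<comment> \<open>Moving the diagonal units to the right past \<open>?T p\<close> adds its weight:
    coordinate p is 1 unless p = 1, and coordinate p + 1 is 0.\<close>
  also have "\<dots> \<approx> ?T p * (gen p p - ?s * gen (p + 1) (p + 1) + (if 1 < p then 1 else 0))"
  proof -
    have wt: "gen i i * ?T p \<approx> ?T p * gen i i + scal (root_weight (p, 1) i) * ?T p"
      if "i \<in> {p, p + 1}" for i
      using has_wt_theta_upto[of p m n] p that
      unfolding eqv_def has_wt_def by (intro relations_mem) (auto simp: algebra_simps)
    have "gen p p * ?T p - ?s * (gen (p + 1) (p + 1) * ?T p) \<approx>
        (?T p * gen p p + scal (root_weight (p, 1) p) * ?T p)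
        - ?s * (?T p * gen (p + 1) (p + 1) + scal (root_weight (p, 1) (p + 1)) * ?T p)"
      by (intro eqv_diff eqv_lmult wt) auto
    then show ?thesis
      using p by (auto simp: root_weight_def dual_def algebra_simps)
  qed
  finally have last: "?e * (gen (p + 1) p * ?T p) \<approx>
      ?T p * (gen p p - ?s * gen (p + 1) (p + 1) + (if 1 < p then 1 else 0))" .
  have sum_eq: "(\<Sum>b\<in>{1..<p}. gen p b * (?T b * ?A b (p + 1)))
      = (if 1 < p then ?T p * h_elt m n (p - 1) else 0)"
  proof (cases "1 < p")
    case True
    have "gen p b * (?T b * ?A b (p + 1)) = gen p b * (?T b * ?A b p) * h_elt m n (p - 1)"
      if "b \<in> {1..<p}" for b
    proof -
      have "?A b (p + 1) = ?A b p * h_elt m n (p - 1)"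
        using that by (intro h_between_Suc) auto
      then show ?thesis by (simp only: mult.assoc)
    qed
    then have "(\<Sum>b\<in>{1..<p}. gen p b * (?T b * ?A b (p + 1)))
        = (\<Sum>b\<in>{1..<p}. gen p b * (?T b * ?A b p) * h_elt m n (p - 1))"
      by (rule sum.cong[OF refl])
    also have "\<dots> = ?T p * h_elt m n (p - 1)"
      using True theta_upto_rec[of p m n] by (simp add: sum_distrib_right)
    finally show ?thesis
      using True by simp
  qed auto
  have expand: "?e * ?T (p + 1) =
      (\<Sum>b\<in>{1..<p}. ?e * (gen (p + 1) b * (?T b * ?A b (p + 1)))) + ?e * (gen (p + 1) p * ?T p)"
    using p theta_upto_rec[of "p + 1" m n] h_between_self[of m n p]
    by (simp add: sum_distrib_left distrib_left)
  have "?e * ?T (p + 1) \<approx> (if 1 < p then ?T p * h_elt m n (p - 1) else 0)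
      + ?T p * (gen p p - ?s * gen (p + 1) (p + 1) + (if 1 < p then 1 else 0))"
    unfolding expand sum_eq[symmetric] by (intro eqv_add eqv_sum below last)
  also have "\<dots> = ?T p * raised_factor m n p"
    by (simp add: raised_factor_def distrib_left)
  finally show ?thesis .
qed

text \<open>Only the terms b = p and b = p + 1 of the recursion survive, and both begin with
  \<open>gen k (p + 1)\<close> times \<open>T\<^sub>p\<close>. As \<open>A\<^sub>p\<^sub>k\<close>
  begins with \<open>h_elt m n p\<close>, what follows in their sum is the element in
  \<open>factor\<close>, which is 0 for p \<noteq> m and \<open>zeta m n\<close> for p = m.\<close>

lemma raise_below:
  assumes "1 \<le> p" "p + 1 < k" "k \<le> m + n"
    and factor: "raised_factor m n p - (if p = m then -1 else 1) * h_elt m n p \<in> L"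
  shows "gen p (p + 1) * theta_upto m n k \<in> L"
  using assms(2,3)
proof (induction k rule: less_induct)
  case (less k)
  let ?T = "theta_upto m n" and ?A = "h_between m n" and ?e = "gen p (p + 1)"
  let ?s = "if p = m then -1 else 1 :: free_alg"
  let ?t = "\<lambda>b. ?e * (gen k b * (?T b * ?A b k))"
  have pass: "?t b \<in> L" if b: "b \<in> {1..<k}" "b \<noteq> p" "?e * ?T b \<in> L" for b
  proof -
    let ?w = "?T b * ?A b k"
    have "?e * ?T b * ?A b k \<in> L"
      using b by (intro rmult_mem[OF h_between_subalg])
    then have "?e * ?w \<in> L"
      by (simp add: mult.assoc)
    from eqv_commute_mem[OF _ this, of k b] show ?thesis
      using b less.prems assms by (auto simp: eqv_0_iff)
  qed
  have "?t b \<in> L" if b: "b \<in> {1..<k} - {p, p + 1}" for b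
  proof (rule pass)
    show "?e * ?T b \<in> L"
    proof (cases "b < p")
      case True
      with b assms(1) less.prems show ?thesis by (intro raise_above) auto
    next
      case False
      with b less.prems show ?thesis by (intro less.IH) auto
    qed
  qed (use b in auto)
  then have "(\<Sum>b\<in>{1..<k} - {p, p + 1}. ?t b) \<approx> 0"
    unfolding eqv_0_iff by (rule sum_mem)
  moreover have "?t p \<approx> - ?s * (gen k (p + 1) * (?T p * ?A p k))"
  proof -
    let ?w = "?T p * ?A p k"
    have "?e * ?T p * ?A p k \<in> L"
      using assms less.prems by (intro rmult_mem[OF h_between_subalg] raise_above) auto
    then have "?e * ?w \<in> L"
      by (simp add: mult.assoc)
    moreover have "odd_unit m p (p + 1) \<and> odd_unit m k p \<longleftrightarrow> p = m"
      using less.prems by (auto simp: odd_unit_def)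
    ultimately show ?thesis
      using eqv_commute_mem[of p "p + 1" k p ?w] assms less.prems by auto
  qed
  moreover have "?t (p + 1) \<approx> gen k (p + 1) * (?T p * (raised_factor m n p * ?A (p + 1) k))"
  proof -
    let ?w = "?T (p + 1) * ?A (p + 1) k"
    \<comment> \<open>For p = m both k and p + 1 exceed m, so \<open>gen k (p + 1)\<close> is even
      and is passed without a sign.\<close>
    have "\<not> (odd_unit m p (p + 1) \<and> odd_unit m k (p + 1))"
      using less.prems by (auto simp: odd_unit_def)
    then have "?t (p + 1) \<approx> gen k (p + 1) * (?e * ?w)"
      using eqv_commute[of p "p + 1" k "p + 1" ?w] assms less.prems by auto
    also have "(?e * ?T (p + 1) - ?T p * raised_factor m n p) * ?A (p + 1) k \<in> L"
      using raise_equal[of p] assms less.prems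
      by (intro rmult_mem[OF h_between_subalg]) (auto simp: eqv_def)
    then have "gen k (p + 1) * (?e * ?w) \<approx>
        gen k (p + 1) * (?T p * (raised_factor m n p * ?A (p + 1) k))"
      by (intro eqv_lmult) (simp add: eqv_def algebra_simps mult.assoc)
    finally show ?thesis .
  qed
  ultimately have "(\<Sum>b\<in>{1..<k} - {p, p + 1}. ?t b) + (?t p + ?t (p + 1)) \<approx>
      0 + (- ?s * (gen k (p + 1) * (?T p * ?A p k))
      + gen k (p + 1) * (?T p * (raised_factor m n p * ?A (p + 1) k)))"
    by (intro eqv_add)
  also have "\<dots> = gen k (p + 1) * (?T p *
      ((raised_factor m n p - ?s * h_elt m n p) * ?A (p + 1) k))"
    using less.prems by (auto simp: h_between_step algebra_simps)
  also have "\<dots> \<approx> 0"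
    unfolding eqv_0_iff using factor by (intro lmult_mem rmult_mem[OF h_between_subalg])
  also have "(\<Sum>b\<in>{1..<k} - {p, p + 1}. ?t b) + (?t p + ?t (p + 1)) = ?e * ?T k"
  proof -
    have "sum ?t {1..<k} = sum ?t ({1..<k} - {p, p + 1}) + sum ?t {p, p + 1}"
      using assms less.prems by (intro sum.subset_diff) auto
    then show ?thesis
      using assms less.prems by (simp add: theta_upto_rec[of k] sum_distrib_left)
  qed
  finally show ?case by (simp add: eqv_0_iff)
qed

end

section \<open>Expansion of the recursion over chains\<close>

definition chains :: "nat \<Rightarrow> nat set set" where
  "chains k = {J. J \<subseteq> {1..k} \<and> 1 \<in> J \<and> k \<in> J}"

lemma finite_chains: "finite (chains k)"
  unfolding chains_def by (rule finite_subset[of _ "Pow {1..k}"]) auto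

lemma chains_1: "chains (Suc 0) = {{1}}"
  by (auto simp: chains_def)

text \<open>Chains are sorted by their second largest element b.\<close>

lemma chains_rec:
  assumes "2 \<le> k"
  shows "chains k = (\<Union>b\<in>{1..<k}. insert k ` chains b)"
proof (intro equalityI subsetI)
  fix J assume J: "J \<in> chains k"
  let ?J = "J - {k}" and ?b = "Max (J - {k})"
  have fin: "finite ?J" "1 \<in> ?J"
    using J assms by (auto simp: chains_def intro: finite_subset)
  then have b: "?b \<in> ?J" by (intro Max_in) auto
  with J have "?b \<in> {1..<k}" by (force simp: chains_def)
  moreover have "?J \<in> chains ?b"
    unfolding chains_def mem_Collect_eq
  proof (intro conjI subsetI)
    fix x assume x: "x \<in> ?J"
    with fin have "x \<le> ?b" by (intro Max_ge)
    with x J show "x \<in> {1..?b}" by (auto simp: chains_def)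
  qed (use fin b in auto)
  moreover have "J = insert k ?J"
    using J by (auto simp: chains_def)
  ultimately show "J \<in> (\<Union>b\<in>{1..<k}. insert k ` chains b)" by blast
next
  fix J assume "J \<in> (\<Union>b\<in>{1..<k}. insert k ` chains b)"
  then show "J \<in> chains k" by (fastforce simp: chains_def)
qed

lemma sorted_list_of_set_append:
  fixes A B :: "nat set"
  assumes "finite A" "finite B" "\<And>a b. a \<in> A \<Longrightarrow> b \<in> B \<Longrightarrow> a < b"
  shows "sorted_list_of_set (A \<union> B) = sorted_list_of_set A @ sorted_list_of_set B"
  using assms by (intro sorted_distinct_set_unique) (auto simp: sorted_append intro: less_imp_le)

lemma chain_insert:
  assumes "J \<in> chains b" "b < k"
  shows "chain (insert k J) = (k, b) # chain J"
proof -
  have fin: "finite J" and J: "b \<in> J" "\<And>x. x \<in> J \<Longrightarrow> x \<le> b"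
    using assms by (auto simp: chains_def intro: finite_subset)
  have "sorted_list_of_set (J \<union> {k}) = sorted_list_of_set J @ [k]"
    using fin J assms(2) by (subst sorted_list_of_set_append) (auto intro: le_less_trans)
  moreover have "sorted_list_of_set ((J - {b}) \<union> {b}) = sorted_list_of_set (J - {b}) @ [b]"
    using fin J by (subst sorted_list_of_set_append) (auto intro: le_neq_trans)
  moreover have "(J - {b}) \<union> {b} = J" using J by auto
  ultimately show ?thesis by (simp add: chain_def Let_def)
qed

text \<open>Removing the top element k, with next element b, splits off \<open>gen k b\<close> from
  the word, and splits the complement into the part below b and the gap between b and k, whose
  factors form \<open>h_between m n b k\<close>.\<close>

lemma theta_upto_chains:
  assumes "1 \<le> k"
  shows "theta_upto m n k = (\<Sum>J\<in>chains k. f_elt J *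
    prod_list (map (\<lambda>x. h_elt m n (x - 1)) (sorted_list_of_set ({1..k} - J))))"
  using assms
proof (induction k rule: less_induct)
  case (less k)
  let ?H = "\<lambda>k J. prod_list (map (\<lambda>x. h_elt m n (x - 1)) (sorted_list_of_set ({1..k} - J)))"
  show ?case
  proof (cases "k = 1")
    case True
    then show ?thesis
      by (simp add: chains_1 theta_upto_1 f_elt_def)
  next
    case False
    have step: "f_elt (insert k J) * ?H k (insert k J) = gen k b * (f_elt J * ?H b J * h_between m n b k)"
      if b: "b \<in> {1..<k}" and J: "J \<in> chains b" for b J
    proof -
      have "{1..k} - insert k J = ({1..b} - J) \<union> {b+1..<k}"
        using b J by (auto simp: chains_def)
      moreover have "sorted_list_of_set (({1..b} - J) \<union> {b+1..<k})
          = sorted_list_of_set ({1..b} - J) @ [b+1..<k]"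
        by (subst sorted_list_of_set_append) auto
      moreover have "f_elt (insert k J) = gen k b * f_elt J"
        using chain_insert[OF J] b by (simp add: f_elt_chain gen_def mult_single plus_word_def)
      ultimately show ?thesis by (simp add: h_between_def mult.assoc)
    qed
    have inj: "inj_on (insert k) (chains b)" if "b < k" for b
      by (rule inj_onI) (use that in \<open>auto simp: chains_def dest!: insert_ident[THEN iffD1, rotated 2]\<close>)
    have "(\<Sum>J\<in>chains k. f_elt J * ?H k J)
        = (\<Sum>b\<in>{1..<k}. \<Sum>J\<in>insert k ` chains b. f_elt J * ?H k J)"
    proof (subst chains_rec)
      show "2 \<le> k" using False less.prems by simp
      have "insert k ` chains b \<inter> insert k ` chains b' = {}" if "b \<in> {1..<k}" "b' \<in> {1..<k}" "b < b'" for b b'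
      proof -
        have "b' \<in> insert k J'" "b' \<notin> insert k J" if "J \<in> chains b" "J' \<in> chains b'" for J J'
          using that \<open>b < b'\<close> \<open>b' \<in> {1..<k}\<close> by (auto simp: chains_def)
        then show ?thesis by blast
      qed
      then show "(\<Sum>J\<in>(\<Union>b\<in>{1..<k}. insert k ` chains b). f_elt J * ?H k J)
        = (\<Sum>b\<in>{1..<k}. \<Sum>J\<in>insert k ` chains b. f_elt J * ?H k J)"
        by (intro sum.UNION_disjoint) (auto simp: finite_chains neq_iff simp del: insert_ident, blast+)
    qed
    also have "\<dots> = (\<Sum>b\<in>{1..<k}. gen k b * (theta_upto m n b * h_between m n b k))"
      using less step
      by (intro sum.cong refl)
        (auto simp: sum.reindex inj sum_distrib_left sum_distrib_right o_def intro!: sum.cong)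
    also have "\<dots> = theta_upto m n k"
      using False less.prems by (simp add: theta_upto_rec[of k])
    finally show ?thesis by simp
  qed
qed

lemma Theta_eq_theta_upto:
  assumes "1 \<le> m"
  shows "Theta m n = theta_upto m n (m + n)"
proof -
  have "H_elt m n J = prod_list (map (\<lambda>x. h_elt m n (x - 1)) (sorted_list_of_set ({1..m+n} - J)))"
    if J: "J \<in> chains (m + n)" for J
  proof -
    let ?l = "sorted_list_of_set ({1..m+n} - J)"
    \<comment> \<open>As 1 belongs to J, the complement starts at 2 or later, and truncated
      subtraction of 1 is injective on it.\<close>
    have ge: "2 \<le> x" if "x \<in> {1..m+n} - J" for x
    proof -
      have "x \<noteq> 1" "1 \<le> x" using J that by (auto simp: chains_def)
      then show ?thesis by simp
    qed
    have "sorted_list_of_set (r_set m n J) = map (\<lambda>x. x - 1) ?l"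
    proof (rule sorted_distinct_set_unique)
      show "sorted (map (\<lambda>x. x - 1) ?l)"
        by (rule sorted_map_mono) (auto intro: monoI mono_onI)
      show "distinct (map (\<lambda>x. x - 1) ?l)"
        using ge by (auto simp: distinct_map intro!: inj_onI)
      have "finite (r_set m n J)" by (simp add: r_set_def)
      then show "set (sorted_list_of_set (r_set m n J)) = set (map (\<lambda>x. x - 1) ?l)"
        by (auto simp: r_set_def)
    qed auto
    then show ?thesis by (simp add: H_elt_def o_def)
  qed
  moreover have "index_sets m n = chains (m + n)"
    by (simp add: index_sets_def chains_def)
  ultimately show ?thesis
    using assms by (simp add: Theta_def theta_upto_chains)
qed

section \<open>The Weyl vector and explicit Cartan elements\<close>

lemma finite_pos_roots: "finite (pos_roots m n)"
  by (rule finite_subset[of _ "{1..m+n} \<times> {1..m+n}"]) (auto simp: pos_roots_def)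

lemma sum_root_weight:
  assumes "finite A"
  shows "(\<Sum>\<alpha>\<in>A. root_weight \<alpha> k)
    = of_nat (card {\<alpha>\<in>A. fst \<alpha> = k}) - of_nat (card {\<alpha>\<in>A. snd \<alpha> = k})"
proof -
  have "(\<Sum>\<alpha>\<in>A. root_weight \<alpha> k)
      = (\<Sum>\<alpha>\<in>A. if fst \<alpha> = k then 1 else 0) - (\<Sum>\<alpha>\<in>A. if snd \<alpha> = k then 1 else 0)"
    by (simp add: sum_subtractf[symmetric] root_weight_def dual_def case_prod_beta eq_commute)
  then show ?thesis using assms by (simp add: sum.If_cases Int_def)
qed

text \<open>Of the even positive roots, m - k start and k - 1 end at index k; n odd ones start there
  and none ends.\<close>

lemma rho_eps:
  assumes "1 \<le> k" "k \<le> m"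
  shows "rho m n k = (of_nat m - 2 * of_nat k + 1 - of_nat n) / 2"
proof -
  have "{\<alpha> \<in> {\<alpha> \<in> pos_roots m n. \<not> odd_root m \<alpha>}. fst \<alpha> = k} = Pair k ` {k<..m}"
    "{\<alpha> \<in> {\<alpha> \<in> pos_roots m n. \<not> odd_root m \<alpha>}. snd \<alpha> = k} = (\<lambda>i. (i, k)) ` {1..<k}"
    "{\<alpha> \<in> {\<alpha> \<in> pos_roots m n. odd_root m \<alpha>}. fst \<alpha> = k} = Pair k ` {m<..m+n}"
    "{\<alpha> \<in> {\<alpha> \<in> pos_roots m n. odd_root m \<alpha>}. snd \<alpha> = k} = {}"
    using assms by (auto simp: pos_roots_def odd_root_def odd_unit_def)
  then show ?thesis
    using assms by (simp add: rho_def sum_root_weight finite_pos_roots card_image inj_on_def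
        of_nat_diff field_simps)
qed

lemma rho_del:
  assumes "m < k" "k \<le> m + n"
  shows "rho m n k = (3 * of_nat m + of_nat n + 1 - 2 * of_nat k) / 2"
proof -
  have "{\<alpha> \<in> {\<alpha> \<in> pos_roots m n. \<not> odd_root m \<alpha>}. fst \<alpha> = k} = Pair k ` {k<..m+n}"
    "{\<alpha> \<in> {\<alpha> \<in> pos_roots m n. \<not> odd_root m \<alpha>}. snd \<alpha> = k} = (\<lambda>i. (i, k)) ` {m<..<k}"
    "{\<alpha> \<in> {\<alpha> \<in> pos_roots m n. odd_root m \<alpha>}. fst \<alpha> = k} = {}"
    "{\<alpha> \<in> {\<alpha> \<in> pos_roots m n. odd_root m \<alpha>}. snd \<alpha> = k} = (\<lambda>i. (i, k)) ` {1..m}"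
    using assms by (auto simp: pos_roots_def odd_root_def odd_unit_def)
  then show ?thesis
    using assms by (simp add: rho_def sum_root_weight finite_pos_roots card_image inj_on_def
        of_nat_diff field_simps)
qed

lemma bil_dual:
  assumes "x \<in> {1..m+n}"
  shows "bil m n a (dual x) = (if x \<le> m then a x else - a x)"
  using assms by (auto simp: bil_def dual_def if_distrib[of "(*) _"] cong: if_cong)

lemma bil_root_weight:
  assumes "x \<in> {1..m+n}" "y \<in> {1..m+n}"
  shows "bil m n a (\<lambda>k. dual x k - dual y k)
    = (if x \<le> m then a x else - a x) - (if y \<le> m then a y else - a y)"
proof -
  have "bil m n a (\<lambda>k. dual x k - dual y k) = bil m n a (dual x) - bil m n a (dual y)"
    by (simp add: bil_def right_diff_distrib sum_subtractf)
  then show ?thesis using assms by (simp add: bil_dual)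
qed

lemma h_of_root_weight:
  assumes "x \<in> {1..m+n}" "y \<in> {1..m+n}"
  shows "h_of m n (\<lambda>k. dual x k - dual y k)
    = (if x \<le> m then gen x x else - gen x x) - (if y \<le> m then gen y y else - gen y y)"
proof -
  have "h_of m n (\<lambda>k. dual x k - dual y k) = (\<Sum>k\<in>{1..m+n}.
      (if k = x then (if x \<le> m then gen x x else - gen x x) else 0)
      - (if k = y then (if y \<le> m then gen y y else - gen y y) else 0))"
    unfolding h_of_def
  proof (rule sum.cong[OF refl])
    fix k assume "k \<in> {1..m+n}"
    note bil = bil_dual[OF this, of "\<lambda>k. dual x k - dual y k"]
    show "scal (bil m n (\<lambda>k. dual x k - dual y k) (dual k)) * gen k k =
      (if k = x then (if x \<le> m then gen x x else - gen x x) else 0)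
      - (if k = y then (if y \<le> m then gen y y else - gen y y) else 0)"
      unfolding bil by (auto simp: dual_def scal_diff scal_uminus)
  qed
  then show ?thesis using assms by (simp add: sum_subtractf)
qed

lemma h_elt_low:
  assumes "1 \<le> i" "i < m"
  shows "h_elt m n i = gen 1 1 - gen (i + 1) (i + 1) + of_nat i - 1"
proof -
  have "bil m n (rho m n) (sigma i) = of_nat i"
    using assms by (simp add: sigma_def eps_def bil_root_weight rho_eps field_simps)
  moreover have "i \<le> m - 1" using assms by simp
  ultimately show ?thesis
    using assms by (simp add: h_elt_def sigma_def eps_def h_of_root_weight scal_diff scal_of_nat algebra_simps)
qed

text \<open>The range includes i = m + n - 1, one beyond the indices in \<open>r_set\<close>: there
  the formula gives 0, which \<open>raise_Theta_simple\<close> uses for the last simple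
  root.\<close>

lemma h_elt_high:
  assumes "1 \<le> m" "m \<le> i" "i < m + n"
  shows "h_elt m n i = gen (m + n) (m + n) - gen (i + 1) (i + 1) + of_nat i + 1 - of_nat m - of_nat n"
proof -
  have tau: "tau m n (i + 1 - m) = (\<lambda>k. dual (i + 1) k - dual (m + n) k)"
    using assms by (simp add: tau_def del_def)
  have bil: "bil m n (rho m n) (tau m n (i + 1 - m)) = of_nat i + 1 - of_nat m - of_nat n"
    unfolding tau using assms by (simp add: bil_root_weight rho_del field_simps)
  have h: "h_of m n (tau m n (i + 1 - m)) = gen (m + n) (m + n) - gen (i + 1) (i + 1)"
    unfolding tau using assms by (simp add: h_of_root_weight)
  have "\<not> i \<le> m - 1" using assms by simp
  then show ?thesis
    by (simp only: h_elt_def bil h if_False scal_diff scal_add scal_of_nat scal_1) simp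
qed

text \<open>Acts on a vector of weight \<open>lam\<close> by (lam + rho, eta).\<close>

definition zeta :: "nat \<Rightarrow> nat \<Rightarrow> free_alg" where
  "zeta m n = h_of m n (eta m n) + scal (bil m n (rho m n) (eta m n))"

lemma bil_rho_eta: "1 \<le> m \<Longrightarrow> 1 \<le> n \<Longrightarrow> bil m n (rho m n) (eta m n) = of_nat m - of_nat n"
  by (simp add: eta_def eps_def del_def bil_root_weight rho_eps rho_del field_simps)

lemma zeta_eq:
  "1 \<le> m \<Longrightarrow> 1 \<le> n \<Longrightarrow> zeta m n = gen 1 1 + gen (m + n) (m + n) + of_nat m - of_nat n"
  unfolding zeta_def bil_rho_eta
  by (simp add: eta_def eps_def del_def h_of_root_weight scal_diff scal_of_nat)

text \<open>For p > 1 the unit \<open>gen p p\<close> cancels against the one in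
  \<open>h_elt m n (p - 1)\<close>. The shifts by rho in \<open>h_elt\<close> make the constants
  match.\<close>

lemma raised_factor_eq:
  assumes "1 \<le> m" "1 \<le> n" "1 \<le> p" "p + 1 \<le> m + n"
  shows "raised_factor m n p = (if p = m then zeta m n - h_elt m n p else h_elt m n p)"
proof -
  consider "p < m" "p = 1" | "p < m" "1 < p" | "p = m" "p = 1" | "p = m" "1 < p" | "m < p"
    using assms by linarith
  then show ?thesis
  proof cases
    case 2
    then show ?thesis using assms by (simp add: raised_factor_def h_elt_low of_nat_diff)
  next
    case 4
    then show ?thesis
      using assms by (simp add: raised_factor_def h_elt_low h_elt_high zeta_eq of_nat_diff)
  next
    case 5
    then show ?thesis using assms by (simp add: raised_factor_def h_elt_high of_nat_diff)
  qed (use assms in \<open>simp_all add: raised_factor_def h_elt_low h_elt_high zeta_eq of_nat_diff\<close>)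
qed

section \<open>From simple roots to all positive roots\<close>

context raising
begin

text \<open>For the last simple root \<open>raise_equal\<close> applies to \<open>Theta\<close>
  itself, with factor 0, or \<open>zeta m n\<close> if p = m; the other simple roots follow from
  \<open>raise_below\<close>.\<close>

lemma raise_Theta_simple:
  assumes "1 \<le> m" "1 \<le> n" "1 \<le> p" "p + 1 \<le> m + n" and zeta: "p = m \<Longrightarrow> zeta m n \<in> L"
  shows "gen p (p + 1) * Theta m n \<in> L"
proof (cases "p + 1 = m + n")
  case True
  then have "of_nat p + 1 = (of_nat m + of_nat n :: free_alg)"
    by (metis of_nat_1 of_nat_add)
  with True have "h_elt m n p = 0" using assms by (subst h_elt_high) auto
  then have "raised_factor m n p \<in> L"
    using assms by (cases "p = m") (simp_all add: raised_factor_eq zero_mem)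
  with raise_equal[of p] assms True show ?thesis
    by (simp add: Theta_eq_theta_upto eqv_mem lmult_mem)
next
  case False
  have "raised_factor m n p - (if p = m then -1 else 1) * h_elt m n p \<in> L"
    using assms by (simp add: raised_factor_eq zero_mem)
  with False assms(3,4) have "gen p (p + 1) * theta_upto m n (m + n) \<in> L"
    by (intro raise_below) auto
  with assms(1) show ?thesis by (simp add: Theta_eq_theta_upto)
qed

text \<open>Induction through the bracket of \<open>gen i j\<close> with
  \<open>gen j (Suc j)\<close>. The only odd simple root, at m, enters only if the given root is
  odd, so even roots do not call for \<open>zeta\<close>.\<close>

lemma raise_Theta:
  assumes "1 \<le> m" "1 \<le> n" "1 \<le> i" "i < j" "j \<le> m + n"
    and zeta: "odd_unit m i j \<Longrightarrow> zeta m n \<in> L"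
  shows "gen i j * Theta m n \<in> L"
  using assms(4,5,6)
proof (induction j)
  case 0
  then show ?case by simp
next
  case (Suc j)
  show ?case
  proof (cases "i = j")
    case True
    then show ?thesis
      using raise_Theta_simple[of i] Suc.prems assms(1-3) by (auto simp: odd_unit_def)
  next
    case False
    with Suc.prems have ij: "i < j" by simp
    have "odd_unit m i (Suc j)" if "odd_unit m i j \<or> j = m"
      using that ij by (auto simp: odd_unit_def)
    with Suc.prems have "odd_unit m i j \<or> j = m \<Longrightarrow> zeta m n \<in> L" by blast
    then have "gen i j * Theta m n \<in> L" "gen j (Suc j) * Theta m n \<in> L"
      using ij Suc.IH Suc.prems raise_Theta_simple[of j] assms(1-3) by auto
    moreover from this have "gen i j * (gen j (Suc j) * Theta m n) \<approx> gen i (Suc j) * Theta m n"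
      using eqv_commute_mem[of i j j "Suc j" "Theta m n"] ij Suc.prems assms(3) by auto
    ultimately show ?thesis
      by (simp add: lmult_mem flip: eqv_mem)
  qed
qed

lemma even_raise_Theta:
  assumes "1 \<le> m" "1 \<le> n" "(i, j) \<in> pos_roots m n" "\<not> odd_root m (i, j)"
  shows "gen i j * Theta m n \<in> L"
  using assms by (intro raise_Theta) (auto simp: pos_roots_def odd_root_def)

end

text \<open>If a generator s has weight \<mu>, then s h is congruent to (h - \<mu>(h)) s modulo the
  relations, so the left ideal is stable under right multiplication by h.\<close>

lemma raising_left_ideal:
  assumes "\<And>z. z \<in> Z \<Longrightarrow> has_wt m n z (\<lambda>_. 0)"
  shows "raising m n (left_ideal (two_sided_ideal (gl_relations m n) \<union> n_plus m n \<union> Z))"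
    (is "raising m n ?L")
proof -
  let ?I = "two_sided_ideal (gl_relations m n)"
  have I: "x \<in> ?I \<Longrightarrow> x \<in> ?L" for x
    by (simp add: left_ideal_base)
  have rmult: "x * gen i i \<in> ?L" if "x \<in> ?L" "i \<in> {1..m+n}" for x i
    using that
  proof (induction rule: left_ideal.induct)
    case zero
    then show ?case by (simp add: left_ideal.zero)
  next
    case (mult s a)
    have "s * gen i i \<in> ?L"
    proof (cases "s \<in> ?I")
      case True
      then show ?thesis by (simp add: I two_sided_ideal_rmult)
    next
      case False
      with mult consider "s \<in> Z" | k l where "s = gen k l" "1 \<le> k" "k < l" "l \<le> m + n"
        by (auto simp: n_plus_def)
      then have "\<exists>\<mu>. has_wt m n s \<mu>"
      proof cases
        case 2
        then show ?thesis using has_wt_gen[of k m n l] by auto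
      qed (use assms in blast)
      then obtain \<mu> where \<mu>: "gen i i * s - s * gen i i - scal (\<mu> i) * s \<in> ?I"
        using mult.prems unfolding has_wt_def by blast
      have "s * gen i i = - (gen i i * s - s * gen i i - scal (\<mu> i) * s) + (gen i i - scal (\<mu> i)) * s"
        by (simp add: algebra_simps)
      also have "\<dots> \<in> ?L"
        using \<mu> mult by (intro left_ideal.add I two_sided_ideal_uminus left_ideal.mult) auto
      finally show ?thesis .
    qed
    then show ?case by (simp add: left_ideal_lmult mult.assoc)
  next
    case (add x y)
    then show ?case by (simp add: distrib_right left_ideal.add)
  qed
  show ?thesis
    by unfold_locales (auto intro: left_ideal.add left_ideal_lmult left_ideal_base rmult)
qed

lemma has_wt_zeta: "has_wt m n (zeta m n) (\<lambda>_. 0)"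
  unfolding zeta_def
  by (intro has_wt_subalg_h_gens subalg.add subalg.scal h_of_subalg)

lemma even_raise_Theta_left_ideal:
  assumes "1 \<le> m" "1 \<le> n" "(i, j) \<in> pos_roots m n" "\<not> odd_root m (i, j)"
  shows "gen i j * Theta m n \<in> left_ideal (two_sided_ideal (gl_relations m n) \<union> n_plus m n)"
  using raising.even_raise_Theta[OF raising_left_ideal[of "{}"]] assms by simp

text \<open>Stated before any choice of \<open>lam\<close>, so that it serves both the highest
  weight vector and the Sapovalov condition.\<close>

lemma raise_Theta_left_ideal:
  assumes "1 \<le> m" "1 \<le> n" "(i, j) \<in> pos_roots m n"
  shows "gen i j * Theta m n \<in>
    left_ideal (two_sided_ideal (gl_relations m n) \<union> n_plus m n \<union> {zeta m n})"
proof -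
  interpret raising m n "left_ideal (two_sided_ideal (gl_relations m n) \<union> n_plus m n \<union> {zeta m n})"
    using raising_left_ideal[of "{zeta m n}"] has_wt_zeta by simp
  show ?thesis
    using assms by (intro raise_Theta) (auto simp: pos_roots_def left_ideal_base)
qed

section \<open>Highest weight vectors in the Verma module\<close>

text \<open>Representatives of U(n^-); by \<open>exists_nminus_span\<close> they reach all of
  M(lam).\<close>

inductive_set nminus_span :: "nat \<Rightarrow> nat \<Rightarrow> free_alg set" for m n where
  scal: "scal c \<in> nminus_span m n"
| gen: "x \<in> nminus_span m n \<Longrightarrow> 1 \<le> j \<Longrightarrow> j < i \<Longrightarrow> i \<le> m + n \<Longrightarrow> gen i j * x \<in> nminus_span m n"
| add: "x \<in> nminus_span m n \<Longrightarrow> y \<in> nminus_span m n \<Longrightarrow> x + y \<in> nminus_span m n"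

lemma nminus_span_scal: "x \<in> nminus_span m n \<Longrightarrow> scal c * x \<in> nminus_span m n"
proof (induction rule: nminus_span.induct)
  case (scal d)
  show ?case using nminus_span.scal[of "c * d"] by (simp add: scal_mult)
next
  case (gen x j i)
  have "scal c * (gen i j * x) = gen i j * (scal c * x)"
    by (metis mult.assoc scal_commute)
  with gen show ?case by (simp add: nminus_span.gen)
next
  case (add x y)
  then show ?case by (simp add: distrib_left nminus_span.add)
qed

locale verma_module =
  fixes m n :: nat and lam :: weight
begin

abbreviation "V \<equiv> verma_ideal m n lam"

sublocale gl_left_ideal m n V
  by (rule gl_left_ideal_verma)

notation eqv (infix "\<approx>" 50)

lemma gen_upper_mem: "1 \<le> i \<Longrightarrow> i < j \<Longrightarrow> j \<le> m + n \<Longrightarrow> gen i j \<in> V"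
  unfolding verma_ideal_def by (rule left_ideal_base) (auto simp: n_plus_def)

lemma gen_diag: "i \<in> {1..m+n} \<Longrightarrow> gen i i \<approx> scal (lam i)"
  unfolding eqv_def unfolding verma_ideal_def by (rule left_ideal_base) auto

lemma gen_outside_mem:
  assumes "\<not> {i, j} \<subseteq> {1..m+n}"
  shows "gen i j * x \<in> V"
proof -
  have "gen i j \<in> gl_relations m n"
    unfolding gl_relations_def using assms by blast
  then show ?thesis
    by (intro relations_mem two_sided_ideal_rmult two_sided_ideal_base)
qed

text \<open>Commuting \<open>gen i j\<close> past the first letter \<open>gen k l\<close> leaves
  \<open>gen i j\<close>, \<open>gen i l\<close> and \<open>gen k j\<close> applied to the shorter
  x; hence the indices are arbitrary in the induction.\<close>

lemma gen_nminus_span: "x \<in> nminus_span m n \<Longrightarrow> \<exists>y\<in>nminus_span m n. gen i j * x \<approx> y"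
proof (induction arbitrary: i j rule: nminus_span.induct)
  case (scal c)
  have "gen i j * scal c = scal c * gen i j" by (simp add: scal_commute)
  moreover consider "\<not> {i, j} \<subseteq> {1..m+n}" | "{i, j} \<subseteq> {1..m+n}" "i < j"
    | "{i, j} \<subseteq> {1..m+n}" "i = j" | "{i, j} \<subseteq> {1..m+n}" "j < i"
    by linarith
  then have "\<exists>y\<in>nminus_span m n. gen i j * scal c \<approx> y"
  proof cases
    case 1
    then have "gen i j * scal c \<approx> scal 0" by (simp add: gen_outside_mem eqv_0_iff del: insert_subset)
    then show ?thesis using nminus_span.scal by blast
  next
    case 2
    then have "scal c * gen i j \<approx> scal 0" by (simp add: eqv_0_iff lmult_mem gen_upper_mem)
    then show ?thesis unfolding scal_commute using nminus_span.scal by blast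
  next
    case 3
    then have "scal c * gen i j \<approx> scal c * scal (lam i)" by (intro eqv_lmult) (simp add: gen_diag)
    then show ?thesis unfolding scal_commute[of c "gen i j"] scal_mult[symmetric] using nminus_span.scal by blast
  next
    case 4
    then have "gen i j * scal c \<in> nminus_span m n" by (auto intro: nminus_span.intros)
    then show ?thesis using eqv_refl by blast
  qed
  then show ?case .
next
  case (gen x l k)
  show ?case
  proof (cases "{i, j} \<subseteq> {1..m+n}")
    case False
    then have "gen i j * (gen k l * x) \<approx> scal 0" by (simp add: gen_outside_mem eqv_0_iff del: insert_subset)
    then show ?thesis using nminus_span.scal by blast
  next
    case True
    define s where "s = (if odd_unit m i j \<and> odd_unit m k l then -1 else 1 :: complex)"
    from gen.IH obtain y y' y'' where y: "y \<in> nminus_span m n" "gen i j * x \<approx> y"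
      and y': "y' \<in> nminus_span m n" "gen i l * x \<approx> y'"
      and y'': "y'' \<in> nminus_span m n" "gen k j * x \<approx> y''"
      by metis
    let ?z = "scal s * (gen k l * y) + (scal (if j = k then 1 else 0) * y'
        + scal (if i = l then - s else 0) * y'')"
    have "gen i j * (gen k l * x) \<approx> scal s * (gen k l * (gen i j * x))
        + (scal (if j = k then 1 else 0) * (gen i l * x) + scal (if i = l then - s else 0) * (gen k j * x))"
      using eqv_commute[of i j k l x] True gen.hyps
      by (cases "odd_unit m i j \<and> odd_unit m k l")
        (auto simp: s_def scal_uminus algebra_simps)
    also have "\<dots> \<approx> ?z"
      by (intro eqv_add eqv_lmult y y' y'')
    finally have "gen i j * (gen k l * x) \<approx> ?z" .
    moreover have "?z \<in> nminus_span m n"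
      using y y' y'' gen.hyps by (intro nminus_span.add nminus_span_scal nminus_span.gen)
    ultimately show ?thesis by blast
  qed
next
  case (add x y)
  then obtain x' y' where "x' \<in> nminus_span m n" "gen i j * x \<approx> x'"
    "y' \<in> nminus_span m n" "gen i j * y \<approx> y'" by metis
  then show ?case
    unfolding distrib_left using nminus_span.add eqv_add by blast
qed

lemma exists_nminus_span: "\<exists>y\<in>nminus_span m n. x \<approx> y"
proof (induction x rule: free_alg_induct)
  case (single w c)
  have "\<exists>y\<in>nminus_span m n. Poly_Mapping.single (Word xs) c \<approx> y" for xs
  proof (induction xs)
    case Nil
    have "Poly_Mapping.single (Word []) c = scal c" by (simp add: scal_def zero_word_def)
    then show ?case using nminus_span.scal eqv_refl by metis
  next
    case (Cons x xs)
    obtain i j where x: "x = (i, j)" by (cases x)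
    from Cons obtain y where y: "y \<in> nminus_span m n" "Poly_Mapping.single (Word xs) c \<approx> y" by blast
    have "Poly_Mapping.single (Word (x # xs)) c = gen i j * Poly_Mapping.single (Word xs) c"
      by (simp add: x gen_def mult_single plus_word_def)
    also have "\<dots> \<approx> gen i j * y" using y by (intro eqv_lmult)
    finally show ?case using gen_nminus_span[OF y(1), of i j] eqv_trans by blast
  qed
  then show ?case by (cases w) simp
next
  case (add p q)
  then show ?case using nminus_span.add eqv_add by blast
qed

text \<open>
  \<open>height_op\<close> acts on a nonempty lowering monomial applied to the highest weight vector by a
  positive integer, and by zero on the highest weight vector and on every vector of weight \<open>lam\<close>.
  This singles out the multiples of the highest weight vector without a PBW theorem.
\<close>

definition height_op :: free_alg where
  "height_op = (\<Sum>i\<in>{1..m+n}. of_nat i * (gen i i - scal (lam i)))"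

text \<open>A polynomial in \<open>height_op\<close> given by its roots; a list without 0 has
  nonzero value at 0.\<close>

definition height_prod :: "nat list \<Rightarrow> free_alg" where
  "height_prod ds = prod_list (map (\<lambda>d. height_op - of_nat d) ds)"

lemma height_prod_simps [simp]:
  "height_prod [] = 1" "height_prod (d # ds) = (height_op - of_nat d) * height_prod ds"
  "height_prod (ds @ ds') = height_prod ds * height_prod ds'"
  by (simp_all add: height_prod_def)

lemma height_op_mem: "height_op \<in> V"
  unfolding height_op_def
  by (intro sum_mem lmult_mem) (simp add: gen_diag flip: eqv_def)

lemma height_op_commute: "(height_op - of_nat d) * height_prod ds = height_prod ds * (height_op - of_nat d)"
proof (induction ds)
  case (Cons e ds)
  have diff_diff: "a - b - (c - d) = a - c - (b - d)" for a b c d :: free_alg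
    by simp
  have "(height_op - of_nat d) * (height_op - of_nat e) = (height_op - of_nat e) * (height_op - of_nat d)"
    unfolding left_diff_distrib right_diff_distrib mult_of_nat_commute[of d height_op]
      mult_of_nat_commute[of e height_op] mult_of_nat_commute[of d "of_nat e :: free_alg"]
    by (rule diff_diff)
  then have "(height_op - of_nat d) * height_prod (e # ds)
      = (height_op - of_nat e) * ((height_op - of_nat d) * height_prod ds)"
    by (simp only: height_prod_simps mult.assoc[symmetric])
  with Cons show ?case by (simp only: height_prod_simps mult.assoc)
qed simp

lemma height_prod_commute: "height_prod ds * height_prod es = height_prod es * height_prod ds"
proof (induction ds)
  case (Cons d ds)
  have "height_prod (d # ds) * height_prod es = ((height_op - of_nat d) * height_prod es) * height_prod ds"
    by (simp only: height_prod_simps mult.assoc Cons)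
  then show ?case by (simp only: height_op_commute height_prod_simps mult.assoc)
qed simp

lemma of_nat_left_commute: "x * (of_nat k * y) = of_nat k * (x * y)" for x y :: free_alg
  by (metis mult.assoc mult_of_nat_commute)

lemma scal_left_commute: "x * (scal c * y) = scal c * (x * y)"
  by (metis mult.assoc scal_commute)

lemma scal_sum: "scal (sum f A) = (\<Sum>k\<in>A. scal (f k))"
  by (induction A rule: infinite_finite_induct) (simp_all add: scal_add)

text \<open>The weight of \<open>gen i j\<close> is 1 at i and -1 at j, so weighting the coordinates
  by their index gives i - j.\<close>

lemma height_op_gen:
  assumes "j < i" "1 \<le> j" "i \<le> m + n"
  shows "(height_op - of_nat (d + (i - j))) * (gen i j * y) \<approx> gen i j * ((height_op - of_nat d) * y)"
proof -
  let ?I = "two_sided_ideal (gl_relations m n)" and ?w = "root_weight (i, j)"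
  have I_sum: "(\<And>k. k \<in> A \<Longrightarrow> f k \<in> ?I) \<Longrightarrow> sum f A \<in> ?I" for f :: "nat \<Rightarrow> free_alg" and A
    by (induction A rule: infinite_finite_induct) (auto intro: two_sided_ideal.intros)
  have "(\<Sum>k\<in>{1..m+n}. of_nat k * ?w k) = of_nat i - (of_nat j :: complex)"
    using assms by (simp add: root_weight_def dual_def right_diff_distrib sum_subtractf
        if_distrib[of "(*) _"] cong: if_cong)
  then have "of_nat (i - j) = scal (\<Sum>k\<in>{1..m+n}. of_nat k * ?w k)"
    using assms by (simp add: scal_diff scal_of_nat of_nat_diff)
  then have wt: "of_nat (i - j) * gen i j = (\<Sum>k\<in>{1..m+n}. of_nat k * (scal (?w k) * gen i j))"
    by (simp only: scal_sum scal_mult scal_of_nat sum_distrib_right mult.assoc)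
  have "(\<Sum>k\<in>{1..m+n}. of_nat k * (gen k k * gen i j - gen i j * gen k k - scal (?w k) * gen i j)) \<in> ?I"
    using has_wt_gen[of i m n j] assms unfolding has_wt_def
    by (intro I_sum two_sided_ideal_lmult) auto
  also have "(\<Sum>k\<in>{1..m+n}. of_nat k * (gen k k * gen i j - gen i j * gen k k - scal (?w k) * gen i j))
      = height_op * gen i j - gen i j * height_op - of_nat (i - j) * gen i j"
  proof -
    have "of_nat k * (gen k k * gen i j - gen i j * gen k k - scal (?w k) * gen i j) =
      of_nat k * (gen k k - scal (lam k)) * gen i j - gen i j * (of_nat k * (gen k k - scal (lam k)))
      - of_nat k * (scal (?w k) * gen i j)" for k
      using scal_commute[of "lam k" "gen i j"]
      by (simp add: left_diff_distrib right_diff_distrib of_nat_left_commute mult.assoc)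
    then show ?thesis
      unfolding wt height_op_def by (simp add: sum_subtractf sum_distrib_left sum_distrib_right)
  qed
  finally have "(height_op * gen i j - gen i j * height_op - of_nat (i - j) * gen i j) * y \<in> V"
    by (intro relations_mem two_sided_ideal_rmult)
  then show ?thesis
    by (simp add: eqv_def left_diff_distrib right_diff_distrib distrib_right of_nat_left_commute mult.assoc
        diff_diff_eq add.commute)
qed

lemma height_prod_gen:
  assumes "j < i" "1 \<le> j" "i \<le> m + n"
  shows "height_prod (map (\<lambda>d. d + (i - j)) ds) * (gen i j * y) \<approx> gen i j * (height_prod ds * y)"
proof (induction ds)
  case (Cons d ds)
  have "height_prod (map (\<lambda>d. d + (i - j)) (d # ds)) * (gen i j * y)
      \<approx> (height_op - of_nat (d + (i - j))) * (gen i j * (height_prod ds * y))"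
    using eqv_lmult[OF Cons, of "height_op - of_nat (d + (i - j))"] by (simp add: mult.assoc)
  also have "\<dots> \<approx> gen i j * (height_prod (d # ds) * y)"
    using height_op_gen[OF assms, of d "height_prod ds * y"] by (simp add: mult.assoc)
  finally show ?case .
qed simp

text \<open>Up to a constant c, a vector is a sum of vectors of positive height, each killed by a
  factor with positive root.\<close>

lemma height_prod_kills:
  "x \<in> nminus_span m n \<Longrightarrow> \<exists>ds c. 0 \<notin> set ds \<and> height_prod ds * (x - scal c) \<in> V"
proof (induction rule: nminus_span.induct)
  case (scal c)
  have "height_prod [] * (scal c - scal c) \<in> V" by (simp add: zero_mem)
  then show ?case by (metis empty_iff list.set(1))
next
  case (gen x j i)
  then obtain ds c where ds: "0 \<notin> set ds" "height_prod ds * (x - scal c) \<in> V" by blast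
  let ?ds = "map (\<lambda>d. d + (i - j)) ds"
  have "height_prod ?ds * (gen i j * (x - scal c)) \<in> V"
    using height_prod_gen[of j i ds "x - scal c"] gen ds(2) eqv_mem lmult_mem by blast
  \<comment> \<open>The roots for x are shifted by i - j; the extra root i - j itself kills
    \<open>gen i j\<close> applied to the constant c.\<close>
  then have "height_prod ((i - j) # ?ds) * (gen i j * (x - scal c)) \<in> V"
    by (simp add: mult.assoc lmult_mem)
  moreover have "height_prod ((i - j) # ?ds) * (gen i j * scal c) \<in> V"
  proof -
    have "height_op * scal c \<in> V"
      using lmult_mem[OF height_op_mem, of "scal c"] by (simp add: scal_commute)
    then have "(height_op - of_nat (i - j)) * (gen i j * scal c) \<in> V"
      using height_op_gen[of j i 0 "scal c"] gen by (simp add: eqv_mem lmult_mem)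
    then have "height_prod ?ds * ((height_op - of_nat (i - j)) * (gen i j * scal c)) \<in> V"
      by (rule lmult_mem)
    then show ?thesis
      using height_op_commute[of "i - j" ?ds] by (simp add: mult.assoc[symmetric])
  qed
  ultimately have "height_prod ((i - j) # ?ds) * (gen i j * x - scal 0) \<in> V"
    using add_mem by (fastforce simp: right_diff_distrib distrib_left[symmetric])
  moreover have "0 \<notin> set ((i - j) # ?ds)" using gen by auto
  ultimately show ?case by blast
next
  case (add x y)
  then obtain ds c es d where ds: "0 \<notin> set ds" "height_prod ds * (x - scal c) \<in> V"
    and es: "0 \<notin> set es" "height_prod es * (y - scal d) \<in> V" by blast
  have "height_prod (ds @ es) * (x + y - scal (c + d))
      = height_prod es * (height_prod ds * (x - scal c)) + height_prod ds * (height_prod es * (y - scal d))"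
    using height_prod_commute[of ds es] by (simp add: scal_add mult.assoc[symmetric]) (simp add: algebra_simps)
  also have "\<dots> \<in> V" by (intro add_mem lmult_mem[OF ds(2)] lmult_mem[OF es(2)])
  finally show ?case using ds(1) es(1) by (intro exI[of _ "ds @ es"] exI[of _ "c + d"]) auto
qed

text \<open>As \<open>height_op\<close> kills x - c, the polynomial from
  \<open>height_prod_kills\<close> acts on it by its value at 0. That value is nonzero, yet the
  polynomial kills x - c as well.\<close>

lemma weight_space_highest:
  assumes "\<And>i. i \<in> {1..m+n} \<Longrightarrow> gen i i * x \<approx> scal (lam i) * x"
  shows "\<exists>c. x \<approx> scal c"
proof -
  obtain y where y: "y \<in> nminus_span m n" "x \<approx> y" using exists_nminus_span by blast
  then obtain ds c where ds: "0 \<notin> set ds" "height_prod ds * (y - scal c) \<in> V"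
    using height_prod_kills by blast
  let ?z = "x - scal c"
  have "height_prod ds * ?z \<approx> height_prod ds * (y - scal c)"
    using y by (intro eqv_lmult eqv_diff) auto
  with ds(2) have z: "height_prod ds * ?z \<in> V" by (simp add: eqv_mem)
  have "(\<Sum>i\<in>{1..m+n}. of_nat i * (gen i i * x - scal (lam i) * x)) \<in> V"
    using assms by (intro sum_mem lmult_mem) (simp add: eqv_def)
  moreover have "height_op * x = (\<Sum>i\<in>{1..m+n}. of_nat i * (gen i i * x - scal (lam i) * x))"
    by (simp add: height_op_def sum_distrib_right algebra_simps)
  moreover have "height_op * scal c \<in> V"
    using lmult_mem[OF height_op_mem, of "scal c"] by (simp add: scal_commute)
  ultimately have op: "height_op * ?z \<in> V"
    by (simp add: right_diff_distrib diff_mem)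
  have "height_prod ds * ?z \<approx> scal (\<Prod>d\<leftarrow>ds. - of_nat d) * ?z"
  proof (induction ds)
    case (Cons d ds)
    let ?p = "\<Prod>d\<leftarrow>ds. - of_nat d"
    have "height_prod (d # ds) * ?z \<approx> (height_op - of_nat d) * (scal ?p * ?z)"
      using eqv_lmult[OF Cons, of "height_op - of_nat d"] by (simp add: mult.assoc)
    also have "\<dots> = scal ?p * (height_op * ?z) + scal (- of_nat d * ?p) * ?z"
      by (simp add: left_diff_distrib scal_left_commute[of height_op] scal_mult scal_uminus
          scal_of_nat mult.assoc)
    also have "\<dots> \<approx> scal (- of_nat d * ?p) * ?z"
      by (intro eqv_add_mem lmult_mem[OF op])
    finally show ?case by simp
  qed simp
  with z have "scal (\<Prod>d\<leftarrow>ds. - of_nat d) * ?z \<in> V" by (simp add: eqv_mem)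
  then have "scal (inverse (\<Prod>d\<leftarrow>ds. - of_nat d)) * (scal (\<Prod>d\<leftarrow>ds. - of_nat d) * ?z) \<in> V"
    by (rule lmult_mem)
  moreover have "(\<Prod>d\<leftarrow>ds. - of_nat d :: complex) \<noteq> 0"
    using ds(1) by (simp add: prod_list_zero_iff image_iff)
  ultimately have "?z \<in> V" by (simp add: mult.assoc[symmetric] scal_mult[symmetric])
  then show ?thesis by (auto simp: eqv_def)
qed

lemma subalg_h_gens_scal: "h \<in> subalg (h_gens m n) \<Longrightarrow> \<exists>c. h \<approx> scal c"
proof (induction rule: subalg.induct)
  case (scal c)
  then show ?case using eqv_refl by blast
next
  case (base s)
  then show ?case using gen_diag by (auto simp: h_gens_def)
next
  case (add x y)
  then show ?case using eqv_add by (metis scal_add)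
next
  case (mult x y)
  then obtain c d where x: "x \<approx> scal c" and y: "y \<approx> scal d" by blast
  have "x * y \<approx> x * scal d" using y by (rule eqv_lmult)
  also have "\<dots> = scal d * x" by (simp add: scal_commute)
  also have "\<dots> \<approx> scal d * scal c" using x by (rule eqv_lmult)
  finally show ?case using scal_mult by metis
qed

end

section \<open>Theta applied to a highest weight vector\<close>

lemma H_elt_subalg: "H_elt m n J \<in> subalg (h_gens m n)"
  unfolding H_elt_def by (rule subalg_prod_list) (auto simp: h_elt_subalg)

lemma H_elt_full: "H_elt m n {1..m+n} = 1"
  by (simp add: H_elt_def r_set_def)

lemma has_wt_Theta:
  assumes "1 \<le> m" "1 \<le> n"
  shows "has_wt m n (Theta m n) (\<lambda>i. - eta m n i)"
proof -
  have "root_weight (m + n, 1) = (\<lambda>i. - eta m n i)"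
    by (auto simp: root_weight_def eta_def eps_def del_def)
  then show ?thesis
    using has_wt_theta_upto[of "m + n" m n] assms by (simp add: Theta_eq_theta_upto)
qed

context verma_module
begin

lemma verma_coset_eq_iff: "verma_coset m n lam x = verma_coset m n lam y \<longleftrightarrow> x \<approx> y"
proof
  assume "verma_coset m n lam x = verma_coset m n lam y"
  moreover have "x \<in> verma_coset m n lam x" by (simp add: verma_coset_def zero_mem)
  ultimately show "x \<approx> y" by (simp add: verma_coset_def eqv_def)
next
  assume "x \<approx> y"
  then have "z \<approx> x \<longleftrightarrow> z \<approx> y" for z using eqv_trans eqv_sym by blast
  then show "verma_coset m n lam x = verma_coset m n lam y"
    by (simp add: verma_coset_def eqv_def)
qed

lemma verma_act_coset: "verma_act m n lam u (verma_coset m n lam x) = verma_coset m n lam (u * x)"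
proof -
  have "verma_coset m n lam (u * y) = verma_coset m n lam (u * x)" if "y \<in> verma_coset m n lam x" for y
    unfolding verma_coset_eq_iff using that by (intro eqv_lmult) (simp add: verma_coset_def eqv_def)
  moreover have "x \<in> verma_coset m n lam x" by (simp add: verma_coset_def zero_mem)
  ultimately show ?thesis unfolding verma_act_def by blast
qed

text \<open>On the generator of M(lam) every \<open>H_elt\<close> acts by a scalar, which is 1 for
  the full chain.\<close>

lemma Theta_notin:
  assumes "1 \<le> m" "1 \<notin> V"
  shows "Theta m n \<notin> V"
proof
  have "\<exists>c. H_elt m n J \<approx> scal c \<and> (J = {1..m+n} \<longrightarrow> c = 1)" for J
    using subalg_h_gens_scal[OF H_elt_subalg, of J] H_elt_full[of m n] scal_1
    by (cases "J = {1..m+n}") auto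
  then obtain c where c: "\<And>J. H_elt m n J \<approx> scal (c J)" "c {1..m+n} = 1" by metis
  have "Theta m n \<approx> (\<Sum>J\<in>index_sets m n. f_elt J * scal (c J))"
    unfolding Theta_def by (intro eqv_sum eqv_lmult c)
  moreover assume "Theta m n \<in> V"
  ultimately have "(\<Sum>J\<in>index_sets m n. f_elt J * scal (c J)) \<in> V" by (simp add: eqv_mem)
  with f_elt_combination_notin_verma_ideal[of m n c lam] c assms show False by simp
qed

text \<open>That M(lam) is nonzero is read off the existence of v, which is nonzero by
  definition.\<close>

lemma highest_weight_vector_scal:
  assumes "highest_weight_vector m n lam lam v"
  obtains c where "c \<noteq> 0" "v = verma_coset m n lam (scal c)" "1 \<notin> V"
proof -
  from assms obtain x where v: "v = verma_coset m n lam x"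
    by (auto simp: highest_weight_vector_def weight_vector_def verma_def)
  with assms have "x \<notin> V"
    unfolding highest_weight_vector_def weight_vector_def
    by (auto simp: verma_coset_eq_iff eqv_0_iff)
  have x: "gen i i * x \<approx> scal (lam i) * x" if "i \<in> {1..m+n}" for i
    using that assms unfolding highest_weight_vector_def weight_vector_def v
    by (auto simp: verma_act_coset verma_coset_eq_iff)
  obtain c where c: "x \<approx> scal c" using weight_space_highest[OF x] by blast
  with \<open>x \<notin> V\<close> have nin: "scal c \<notin> V" by (simp add: eqv_mem)
  then have "c \<noteq> 0" by (auto simp: zero_mem)
  moreover have "1 \<notin> V" using lmult_mem[of 1 "scal c"] nin by auto
  moreover have "v = verma_coset m n lam (scal c)" using c by (simp add: v verma_coset_eq_iff)
  ultimately show thesis using that by blast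
qed

lemma zeta_mem:
  assumes "1 \<le> m" "1 \<le> n" "bil m n (\<lambda>k. lam k + rho m n k) (eta m n) = 0"
  shows "zeta m n \<in> V"
proof -
  have "bil m n (\<lambda>k. lam k + rho m n k) (eta m n) = (lam 1 + rho m n 1) + (lam (m + n) + rho m n (m + n))"
    using assms by (simp add: eta_def eps_def del_def bil_root_weight)
  moreover have "bil m n (rho m n) (eta m n) = rho m n 1 + rho m n (m + n)"
    using assms by (simp add: eta_def eps_def del_def bil_root_weight)
  ultimately have "lam 1 + lam (m + n) + (of_nat m - of_nat n) = 0"
    using assms bil_rho_eta[of m n] by (simp add: algebra_simps)
  then have "scal (lam 1) + scal (lam (m + n)) + (of_nat m - of_nat n) = 0"
    by (metis scal_0 scal_add scal_diff scal_of_nat)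
  moreover have "gen 1 1 + gen (m + n) (m + n) + (of_nat m - of_nat n)
      \<approx> scal (lam 1) + scal (lam (m + n)) + (of_nat m - of_nat n)"
    using assms by (intro eqv_add gen_diag eqv_refl) auto
  ultimately show ?thesis
    using assms by (simp add: zeta_eq eqv_0_iff add_diff_eq)
qed

lemma weight_vector_Theta:
  assumes "1 \<le> m" "1 \<le> n" "c \<noteq> 0" "1 \<notin> V"
  shows "weight_vector m n lam (\<lambda>i. lam i - eta m n i) (verma_coset m n lam (Theta m n * scal c))"
  unfolding weight_vector_def
proof (intro conjI ballI)
  let ?T = "Theta m n"
  show "verma_coset m n lam (?T * scal c) \<in> verma m n lam" by (simp add: verma_def)
  have "?T * scal c \<notin> V"
  proof
    assume "?T * scal c \<in> V"
    then have "scal (inverse c) * (?T * scal c) \<in> V" by (rule lmult_mem)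
    also have "scal (inverse c) * (?T * scal c) = scal (inverse c * c) * ?T"
      by (simp add: scal_mult scal_commute[of c] mult.assoc)
    finally show False using Theta_notin[OF assms(1,4)] assms(3) by simp
  qed
  then show "verma_coset m n lam (?T * scal c) \<noteq> verma_coset m n lam 0"
    by (simp add: verma_coset_eq_iff eqv_0_iff)
  fix i assume i: "i \<in> {1..m+n}"
  have "gen i i * ?T - ?T * gen i i - scal (- eta m n i) * ?T \<in> V"
    using has_wt_Theta[OF assms(1,2)] i unfolding has_wt_def by (blast intro: relations_mem)
  then have "gen i i * ?T \<approx> ?T * gen i i + scal (- eta m n i) * ?T"
    by (simp add: eqv_def diff_diff_eq)
  also have "\<dots> \<approx> ?T * scal (lam i) + scal (- eta m n i) * ?T"
    by (intro eqv_add eqv_lmult gen_diag eqv_refl i)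
  also have "\<dots> = scal (lam i - eta m n i) * ?T"
    by (simp add: scal_diff scal_uminus left_diff_distrib scal_commute[of "lam i"])
  finally have "scal c * (gen i i * ?T) \<approx> scal c * (scal (lam i - eta m n i) * ?T)"
    by (rule eqv_lmult)
  then have "gen i i * (?T * scal c) \<approx> scal (lam i - eta m n i) * (?T * scal c)"
    by (simp add: scal_commute[of c] mult.assoc)
  then show "verma_act m n lam (gen i i) (verma_coset m n lam (?T * scal c)) =
      verma_act m n lam (scal (lam i - eta m n i)) (verma_coset m n lam (?T * scal c))"
    by (simp add: verma_act_coset verma_coset_eq_iff)
qed

lemma verma_act_gen_Theta:
  assumes "gen i j * Theta m n \<in> V"
  shows "verma_act m n lam (gen i j) (verma_coset m n lam (Theta m n * scal c)) = verma_coset m n lam 0"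
proof -
  have "gen i j * (Theta m n * scal c) = scal c * (gen i j * Theta m n)"
    by (simp add: scal_commute[of c] mult.assoc)
  then show ?thesis using assms by (simp add: verma_act_coset verma_coset_eq_iff eqv_0_iff lmult_mem)
qed

lemma Theta_even_highest_weight_vector:
  assumes "1 \<le> m" "1 \<le> n" "highest_weight_vector m n lam lam v"
  shows "even_highest_weight_vector m n lam (\<lambda>i. lam i - eta m n i) (verma_act m n lam (Theta m n) v)"
proof -
  obtain c where c: "c \<noteq> 0" "v = verma_coset m n lam (scal c)" "1 \<notin> V"
    using highest_weight_vector_scal[OF assms(3)] .
  have sub: "left_ideal (two_sided_ideal (gl_relations m n) \<union> n_plus m n) \<subseteq> V"
    unfolding verma_ideal_def by (rule left_ideal_mono) auto
  have "gen i j * Theta m n \<in> V" if "(i, j) \<in> pos_roots m n" "\<not> odd_root m (i, j)" for i j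
    using even_raise_Theta_left_ideal[OF assms(1,2) that] sub by blast
  then show ?thesis
    using weight_vector_Theta[OF assms(1,2) c(1,3)]
    by (auto simp: even_highest_weight_vector_def c(2) verma_act_coset[of "Theta m n"]
        intro!: verma_act_gen_Theta)
qed

lemma Theta_highest_weight_vector:
  assumes "1 \<le> m" "1 \<le> n" "highest_weight_vector m n lam lam v"
    "bil m n (\<lambda>k. lam k + rho m n k) (eta m n) = 0"
  shows "highest_weight_vector m n lam (\<lambda>i. lam i - eta m n i) (verma_act m n lam (Theta m n) v)"
proof -
  obtain c where c: "c \<noteq> 0" "v = verma_coset m n lam (scal c)" "1 \<notin> V"
    using highest_weight_vector_scal[OF assms(3)] .
  have sub: "left_ideal (two_sided_ideal (gl_relations m n) \<union> n_plus m n \<union> {zeta m n}) \<subseteq> V"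
  proof
    fix x assume "x \<in> left_ideal (two_sided_ideal (gl_relations m n) \<union> n_plus m n \<union> {zeta m n})"
    then show "x \<in> V"
      using zeta_mem[OF assms(1,2,4)]
      by (induction rule: left_ideal.induct)
        (auto simp: n_plus_def zero_mem add_mem relations_mem intro!: lmult_mem gen_upper_mem)
  qed
  have "gen i j * Theta m n \<in> V" if "(i, j) \<in> pos_roots m n" for i j
    using raise_Theta_left_ideal[OF assms(1,2) that] sub by blast
  then show ?thesis
    using weight_vector_Theta[OF assms(1,2) c(1,3)]
    by (auto simp: highest_weight_vector_def c(2) verma_act_coset[of "Theta m n"]
        intro!: verma_act_gen_Theta)
qed

end

section \<open>The Sapovalov property\<close>

text \<open>Sorts the generators: multiples of relations are absorbed by \<open>U_eq\<close>, those
  of \<open>n_plus\<close> by b, those of \<open>zeta m n\<close> by a.\<close>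

lemma left_ideal_zeta_form:
  assumes "x \<in> left_ideal (two_sided_ideal (gl_relations m n) \<union> n_plus m n \<union> {zeta m n})"
  shows "\<exists>a. \<exists>b\<in>left_ideal (n_plus m n). U_eq m n x (a * zeta m n + b)"
  using assms
proof (induction rule: left_ideal.induct)
  case zero
  then show ?case
    by (auto simp: U_eq_def intro!: exI[of _ 0] bexI[of _ 0] left_ideal.zero two_sided_ideal.zero)
next
  case (mult s a)
  then consider "s \<in> two_sided_ideal (gl_relations m n)" | "s \<in> n_plus m n" | "s = zeta m n" by blast
  then show ?case
  proof cases
    case 1
    then show ?thesis
      by (auto simp: U_eq_def intro!: exI[of _ 0] bexI[of _ 0] left_ideal.zero two_sided_ideal_lmult)
  next
    case 2
    then show ?thesis
      by (auto simp: U_eq_def intro!: exI[of _ 0] bexI[of _ "a * s"] left_ideal.mult two_sided_ideal.zero)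
  next
    case 3
    then show ?thesis
      by (auto simp: U_eq_def intro!: exI[of _ a] bexI[of _ 0] left_ideal.zero two_sided_ideal.zero)
  qed
next
  case (add x y)
  then obtain a b a' b' where b: "b \<in> left_ideal (n_plus m n)" "b' \<in> left_ideal (n_plus m n)"
    and eq: "U_eq m n x (a * zeta m n + b)" "U_eq m n y (a' * zeta m n + b')" by blast
  have "x + y - ((a + a') * zeta m n + (b + b')) = (x - (a * zeta m n + b)) + (y - (a' * zeta m n + b'))"
    by (simp add: distrib_right)
  with eq have "U_eq m n (x + y) ((a + a') * zeta m n + (b + b'))"
    unfolding U_eq_def by (metis two_sided_ideal.add)
  with b show ?case using left_ideal.add by blast
qed

lemma theta_upto_subalg_b_minus:
  "1 \<le> k \<Longrightarrow> k \<le> m + n \<Longrightarrow> theta_upto m n k \<in> subalg (b_minus m n)"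
proof (induction k rule: less_induct)
  case (less k)
  have "h_gens m n \<subseteq> b_minus m n" by (auto simp: h_gens_def b_minus_def)
  then have h: "h_between m n b k \<in> subalg (b_minus m n)" for b
    using subalg_mono h_between_subalg by blast
  show ?case
  proof (cases "k = 1")
    case True
    then show ?thesis using subalg.scal[of 1] by (simp add: theta_upto_1)
  next
    case False
    with less.prems have "2 \<le> k" by simp
    have "gen k b \<in> subalg (b_minus m n)" if "b \<in> {1..<k}" for b
      unfolding b_minus_def using that less.prems
      by (intro subalg.base CollectI exI conjI refl) auto
    then show ?thesis
      unfolding theta_upto_rec[OF \<open>2 \<le> k\<close>] using less
      by (intro subalg_sum subalg.mult h less.IH) auto
  qed
qed

section \<open>Partitions of eta\<close>

lemma partition_sum_weight:
  assumes "\<pi> \<in> partitions m n \<gamma>"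
  shows "(\<Sum>\<alpha>\<in>pos_roots m n. of_nat (\<pi> \<alpha>) * (\<Sum>k\<in>A. c k * root_weight \<alpha> k)) = (\<Sum>k\<in>A. c k * \<gamma> k)"
proof -
  have "(\<Sum>\<alpha>\<in>pos_roots m n. of_nat (\<pi> \<alpha>) * (\<Sum>k\<in>A. c k * root_weight \<alpha> k))
      = (\<Sum>k\<in>A. c k * (\<Sum>\<alpha>\<in>pos_roots m n. of_nat (\<pi> \<alpha>) * root_weight \<alpha> k))"
    unfolding sum_distrib_left by (subst sum.swap) (simp add: mult.left_commute)
  also have "\<dots> = (\<Sum>k\<in>A. c k * \<gamma> k)"
    using assms by (simp add: partitions_def)
  finally show ?thesis .
qed

lemma sum_root_weight_coords:
  assumes "finite A"
  shows "(\<Sum>k\<in>A. c k * root_weight (i, j) k) = (if i \<in> A then c i else 0) - (if j \<in> A then c j else 0)"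
  using assms by (simp add: root_weight_def dual_def right_diff_distrib sum_subtractf
      if_distrib[of "(*) _"] cong: if_cong)

lemma eta_eq_root_weight: "eta m n = root_weight (1, m + n)"
  by (auto simp: eta_def eps_def del_def root_weight_def)

text \<open>The functional with coefficients -k measures height: it is j - i on the root (i, j) and
  m + n - 1 on eta, which bounds the multiplicities.\<close>

lemma partition_le:
  assumes "\<pi> \<in> partitions m n (eta m n)" "\<alpha> \<in> pos_roots m n"
  shows "\<pi> \<alpha> \<le> m + n"
proof -
  have "(\<Sum>\<alpha>\<in>pos_roots m n. of_nat (\<pi> \<alpha>) * (\<Sum>k\<in>{1..m+n}. (- of_nat k) * root_weight \<alpha> k))
      = (\<Sum>k\<in>{1..m+n}. (- of_nat k) * eta m n k)"
    by (rule partition_sum_weight[OF assms(1)])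
  also have "(\<Sum>\<alpha>\<in>pos_roots m n. of_nat (\<pi> \<alpha>) * (\<Sum>k\<in>{1..m+n}. (- of_nat k) * root_weight \<alpha> k))
      = (\<Sum>\<alpha>\<in>pos_roots m n. of_nat (\<pi> \<alpha> * (snd \<alpha> - fst \<alpha>)))"
  proof (rule sum.cong[OF refl])
    fix \<beta> assume "\<beta> \<in> pos_roots m n"
    then obtain a b where \<beta>: "\<beta> = (a, b)" "1 \<le> a" "a < b" "b \<le> m + n" by (auto simp: pos_roots_def)
    then have "(\<Sum>k\<in>{1..m+n}. (- of_nat k) * root_weight \<beta> k) = (of_nat (b - a) :: complex)"
      using sum_root_weight_coords[of "{1..m+n}" "\<lambda>k. - of_nat k" a b] by (simp add: of_nat_diff)
    then show "of_nat (\<pi> \<beta>) * (\<Sum>k\<in>{1..m+n}. (- of_nat k) * root_weight \<beta> k)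
        = (of_nat (\<pi> \<beta> * (snd \<beta> - fst \<beta>)) :: complex)"
      using \<beta> by simp
  qed
  also have "(\<Sum>k\<in>{1..m+n}. (- of_nat k) * eta m n k) = of_nat (m + n - 1)"
    using sum_root_weight_coords[of "{1..m+n}" "\<lambda>k. - of_nat k" 1 "m + n"] assms(2)
    by (auto simp: eta_eq_root_weight of_nat_diff pos_roots_def)
  finally have "(\<Sum>\<alpha>\<in>pos_roots m n. \<pi> \<alpha> * (snd \<alpha> - fst \<alpha>)) = m + n - 1"
    by (simp only: of_nat_sum[symmetric] of_nat_eq_iff)
  moreover have "\<pi> \<alpha> * (snd \<alpha> - fst \<alpha>) \<le> (\<Sum>\<alpha>\<in>pos_roots m n. \<pi> \<alpha> * (snd \<alpha> - fst \<alpha>))"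
    using assms(2) finite_pos_roots by (intro member_le_sum) auto
  moreover have "\<pi> \<alpha> \<le> \<pi> \<alpha> * (snd \<alpha> - fst \<alpha>)"
    using assms(2) by (auto simp: pos_roots_def)
  ultimately show ?thesis by linarith
qed

text \<open>Matters because a sum over an infinite set is 0 by convention.\<close>

lemma finite_partitions: "finite (partitions m n (eta m n))"
proof (rule finite_subset)
  show "partitions m n (eta m n) \<subseteq>
      {\<pi>. \<forall>\<alpha>. (\<alpha> \<in> pos_roots m n \<longrightarrow> \<pi> \<alpha> \<in> {..m+n}) \<and> (\<alpha> \<notin> pos_roots m n \<longrightarrow> \<pi> \<alpha> = 0)}"
    using partition_le by (auto simp: partitions_def)
qed (intro finite_set_of_finite_funs finite_pos_roots finite_atMost)

text \<open>The sum of the first k coordinates is 1 on the simple root (k, k + 1), 0 on all other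
  simple roots, and 1 on eta.\<close>

lemma simple_partition_eq_1:
  assumes "\<pi> \<in> partitions m n (eta m n)" "\<forall>\<alpha>. \<alpha> \<notin> simple_roots m n \<longrightarrow> \<pi> \<alpha> = 0"
    and "1 \<le> k" "k + 1 \<le> m + n"
  shows "\<pi> (k, k + 1) = 1"
proof -
  have "(\<Sum>\<alpha>\<in>pos_roots m n. of_nat (\<pi> \<alpha>) * (\<Sum>l\<in>{1..k}. 1 * root_weight \<alpha> l)) = (\<Sum>l\<in>{1..k}. 1 * eta m n l)"
    by (rule partition_sum_weight[OF assms(1)])
  also have "(\<Sum>l\<in>{1..k}. 1 * eta m n l) = 1"
    using assms(3,4) unfolding eta_eq_root_weight by (subst sum_root_weight_coords) auto
  also have "(\<Sum>\<alpha>\<in>pos_roots m n. of_nat (\<pi> \<alpha>) * (\<Sum>l\<in>{1..k}. 1 * root_weight \<alpha> l))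
      = (\<Sum>\<alpha>\<in>{(k, k + 1)}. of_nat (\<pi> \<alpha>) * (\<Sum>l\<in>{1..k}. 1 * root_weight \<alpha> l))"
  proof (rule sum.mono_neutral_right[OF finite_pos_roots])
    show "{(k, k + 1)} \<subseteq> pos_roots m n" using assms(3,4) by (auto simp: pos_roots_def)
    show "\<forall>\<alpha>\<in>pos_roots m n - {(k, k + 1)}. of_nat (\<pi> \<alpha>) * (\<Sum>l\<in>{1..k}. 1 * root_weight \<alpha> l) = 0"
    proof
      fix \<alpha> assume \<alpha>: "\<alpha> \<in> pos_roots m n - {(k, k + 1)}"
      show "of_nat (\<pi> \<alpha>) * (\<Sum>l\<in>{1..k}. 1 * root_weight \<alpha> l) = 0"
      proof (cases "\<alpha> \<in> simple_roots m n")
        case True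
        then obtain i where i: "\<alpha> = (i, i + 1)" "1 \<le> i" by (auto simp: simple_roots_def)
        with \<alpha> have "i \<le> k \<longleftrightarrow> i + 1 \<le> k" by auto
        with i show ?thesis by (simp only: sum_root_weight_coords finite_atLeastAtMost) auto
      next
        case False
        then have "\<pi> \<alpha> = 0" using assms(2) by blast
        then show ?thesis by simp
      qed
    qed
  qed
  also have "\<dots> = of_nat (\<pi> (k, k + 1))"
    using assms(3) by (simp add: sum_root_weight_coords[of _ "\<lambda>_. 1", simplified])
  finally show ?thesis by simp
qed

lemma simple_partition_unique:
  assumes "\<pi> \<in> partitions m n (eta m n)" "\<forall>\<alpha>. \<alpha> \<notin> simple_roots m n \<longrightarrow> \<pi> \<alpha> = 0"
    and "\<pi>' \<in> partitions m n (eta m n)" "\<forall>\<alpha>. \<alpha> \<notin> simple_roots m n \<longrightarrow> \<pi>' \<alpha> = 0"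
  shows "\<pi> = \<pi>'"
proof
  fix \<alpha>
  show "\<pi> \<alpha> = \<pi>' \<alpha>"
  proof (cases "\<alpha> \<in> simple_roots m n")
    case True
    then show ?thesis
      using simple_partition_eq_1[OF assms(1,2)] simple_partition_eq_1[OF assms(3,4)]
      by (auto simp: simple_roots_def)
  next
    case False
    then have "\<pi> \<alpha> = 0" "\<pi>' \<alpha> = 0" using assms(2,4) by blast+
    then show ?thesis by simp
  qed
qed

lemma e_minus_word:
  "e_minus ord \<pi> = Poly_Mapping.single (Word (concat (map (\<lambda>(i, j). replicate (\<pi> (i, j)) (j, i)) ord))) 1"
proof (induction ord)
  case Nil
  show ?case by (simp add: e_minus_def flip: zero_word_def)
next
  case (Cons \<alpha> ord)
  have "gen j i ^ k = Poly_Mapping.single (Word (replicate k (j, i))) 1" for i j k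
    by (induction k) (simp_all add: gen_def mult_single plus_word_def flip: zero_word_def)
  with Cons show ?case by (cases \<alpha>) (simp add: e_minus_def mult_single plus_word_def)
qed

text \<open>Both sides are single words in the free algebra, so their equality compares them letter
  by letter.\<close>

lemma chain_support:
  assumes "f_elt J = e_minus ord \<pi>"
  shows "set (chain J) = {(j, i) | i j. (i, j) \<in> set ord \<and> 0 < \<pi> (i, j)}"
proof -
  let ?w = "concat (map (\<lambda>(i, j). replicate (\<pi> (i, j)) (j, i)) ord)"
  have "Poly_Mapping.keys (f_elt J) = {Word ?w}" using assms by (simp add: e_minus_word)
  then have "chain J = ?w" by (simp add: f_elt_chain)
  then show ?thesis by (force simp: set_replicate_conv_if split: if_splits)
qed

lemma chain_simple_imp_full:
  assumes "1 \<le> k" "J \<in> chains k" "\<And>a b. (a, b) \<in> set (chain J) \<Longrightarrow> a = b + 1"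
  shows "J = {1..k}"
  using assms
proof (induction k arbitrary: J rule: less_induct)
  case (less k)
  show ?case
  proof (cases "k = 1")
    case True
    then show ?thesis using less.prems by (simp add: chains_1)
  next
    case False
    with less.prems(1,2) obtain b J' where b: "b \<in> {1..<k}" "J' \<in> chains b" "J = insert k J'"
      using chains_rec[of k] by auto
    with chain_insert[of J' b k] have chain: "chain J = (k, b) # chain J'" by simp
    with less.prems(3) have "k = b + 1" by simp
    moreover have "J' = {1..b}"
      using b chain less.prems(3) by (intro less.IH) auto
    ultimately show ?thesis using b by auto
  qed
qed

lemma index_sets_chains: "index_sets m n = chains (m + n)"
  by (simp add: index_sets_def chains_def)

text \<open>The steps of a chain are all simple roots exactly when no index is skipped.\<close>

lemma partition_simple_iff_full:
  assumes "1 \<le> m" "1 \<le> n" "set ord = pos_roots m n" "J \<in> index_sets m n"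
    "\<pi> \<in> partitions m n (eta m n)" "f_elt J = e_minus ord \<pi>"
  shows "(\<forall>\<alpha>. \<alpha> \<notin> simple_roots m n \<longrightarrow> \<pi> \<alpha> = 0) \<longleftrightarrow> J = {1..m+n}"
proof
  assume simple: "\<forall>\<alpha>. \<alpha> \<notin> simple_roots m n \<longrightarrow> \<pi> \<alpha> = 0"
  have step: "a = b + 1" if "(a, b) \<in> set (chain J)" for a b
  proof -
    have "0 < \<pi> (b, a)" using that unfolding chain_support[OF assms(6)] by blast
    then have "(b, a) \<in> simple_roots m n" using simple by force
    then show ?thesis by (auto simp: simple_roots_def)
  qed
  have "1 \<le> m + n" "J \<in> chains (m + n)"
    using assms(1,4) by (auto simp: index_sets_chains)
  then show "J = {1..m+n}" using step by (rule chain_simple_imp_full)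
next
  assume J: "J = {1..m+n}"
  have "{1..m+n} = {1..Suc (m + n - 1)}" using assms(1) by simp
  then have chain: "chain J = map (\<lambda>k. (k + 1, k)) (rev [1..<m+n])"
    using J chain_full[of "m + n - 1"] assms(1) by (simp del: upt_Suc)
  show "\<forall>\<alpha>. \<alpha> \<notin> simple_roots m n \<longrightarrow> \<pi> \<alpha> = 0"
  proof (intro allI impI, rule ccontr)
    fix \<alpha> assume \<alpha>: "\<alpha> \<notin> simple_roots m n" "\<pi> \<alpha> \<noteq> 0"
    obtain i j where ij: "\<alpha> = (i, j)" by (cases \<alpha>)
    from assms(5) have "\<forall>\<alpha>. \<alpha> \<notin> pos_roots m n \<longrightarrow> \<pi> \<alpha> = 0"
      unfolding partitions_def mem_Collect_eq by (rule conjunct1)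
    with \<alpha>(2) have "\<alpha> \<in> pos_roots m n" by metis
    with \<alpha> ij assms(3) have "(j, i) \<in> set (chain J)"
      unfolding chain_support[OF assms(6)] by auto
    with \<alpha> ij show False unfolding chain by (auto simp: simple_roots_def)
  qed
qed

lemma Theta_sapovalov:
  assumes mn: "1 \<le> m" "1 \<le> n" and ord: "admissible_order m n ord"
  shows "sapovalov_element m n ord (eta m n) (Theta m n)"
  unfolding sapovalov_element_def
proof (intro conjI ballI)
  have U_refl: "U_eq m n x x" for x
    by (simp add: U_eq_def two_sided_ideal.zero)
  show "\<exists>x\<in>subalg (b_minus m n). U_eq m n (Theta m n) x"
    using theta_upto_subalg_b_minus[of "m + n" m n] U_refl mn
    by (auto simp: Theta_eq_theta_upto)
  show "U_eq m n (gen i i * Theta m n - Theta m n * gen i i) (scal (- eta m n i) * Theta m n)"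
    if "i \<in> {1..m+n}" for i
    using has_wt_Theta[OF mn] that by (simp add: has_wt_def U_eq_def)
  let ?P = "partitions m n (eta m n)" and ?I = "index_sets m n"
  have set_ord: "set ord = pos_roots m n" using ord by (simp add: admissible_order_def)
  from ord have "\<forall>J\<in>?I. \<exists>\<pi>. \<pi> \<in> ?P \<and> f_elt J = e_minus ord \<pi>"
    unfolding admissible_order_def by blast
  then obtain p where p: "\<And>J. J \<in> ?I \<Longrightarrow> p J \<in> ?P" "\<And>J. J \<in> ?I \<Longrightarrow> f_elt J = e_minus ord (p J)"
    by metis
  \<comment> \<open>Terms of \<open>Theta\<close> with the same chosen partition are collected; a
    partition not of the form \<open>p J\<close> gets coefficient 0.\<close>
  define H where "H \<pi> = (\<Sum>J\<in>{J\<in>?I. p J = \<pi>}. H_elt m n J)" for \<pi>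
  have "Theta m n = (\<Sum>\<pi>\<in>?P. \<Sum>J\<in>{J\<in>?I. p J = \<pi>}. f_elt J * H_elt m n J)"
    unfolding Theta_def using p(1) by (intro sum.group[symmetric] finite_index_sets finite_partitions) auto
  also have "\<dots> = (\<Sum>\<pi>\<in>?P. e_minus ord \<pi> * H \<pi>)"
    unfolding H_def sum_distrib_left by (intro sum.cong refl) (auto simp: p(2))
  finally have Theta: "Theta m n = (\<Sum>\<pi>\<in>?P. e_minus ord \<pi> * H \<pi>)" .
  have full: "{1..m+n} \<in> ?I" using mn by (auto simp: index_sets_def)
  have "H \<pi> = 1" if \<pi>: "\<pi> \<in> ?P" and simple: "\<forall>\<alpha>. \<alpha> \<notin> simple_roots m n \<longrightarrow> \<pi> \<alpha> = 0" for \<pi>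
  proof -
    \<comment> \<open>The full chain yields a partition supported on simple roots, and there is only
      one. No other J is sent to it, so the coefficient is \<open>H_elt m n {1..m+n}\<close>, an
      empty product.\<close>
    have "p {1..m+n} = \<pi>"
      using partition_simple_iff_full[OF mn set_ord full p(1)[OF full] p(2)[OF full]] p(1)[OF full] \<pi> simple
      by (intro simple_partition_unique) auto
    moreover have "J = {1..m+n}" if "J \<in> ?I" "p J = \<pi>" for J
      using partition_simple_iff_full[OF mn set_ord that(1) p(1)[OF that(1)] p(2)[OF that(1)]]
        that(2) simple by simp
    ultimately have "{J\<in>?I. p J = \<pi>} = {{1..m+n}}" using full by blast
    then show ?thesis by (simp only: H_def H_elt_full sum.insert finite.emptyI empty_iff
        not_False_eq_True sum.empty add_0_right)
  qed
  moreover have "H \<pi> \<in> subalg (h_gens m n)" for \<pi>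
    unfolding H_def by (intro subalg_sum H_elt_subalg)
  ultimately show "\<exists>H. (\<forall>\<pi>\<in>?P. H \<pi> \<in> subalg (h_gens m n)) \<and>
      U_eq m n (Theta m n) (\<Sum>\<pi>\<in>?P. e_minus ord \<pi> * H \<pi>) \<and>
      (\<forall>\<pi>\<in>?P. (\<forall>\<alpha>. \<alpha> \<notin> simple_roots m n \<longrightarrow> \<pi> \<alpha> = 0) \<longrightarrow> U_eq m n (H \<pi>) 1)"
    using U_refl Theta by (intro exI[of _ H]) auto
  fix \<alpha> assume "\<alpha> \<in> pos_roots m n"
  then show "case \<alpha> of (i, j) \<Rightarrow> \<exists>a. \<exists>b\<in>left_ideal (n_plus m n).
      U_eq m n (gen i j * Theta m n) (a * (h_of m n (eta m n) + scal (bil m n (rho m n) (eta m n))) + b)"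
    using left_ideal_zeta_form[OF raise_Theta_left_ideal[OF mn]]
    by (cases \<alpha>) (simp add: zeta_def)
qed

theorem theorem2p6:
  fixes m n :: nat
  assumes "1 \<le> m" and "1 \<le> n"
  shows "(\<forall>(lam :: weight) v. highest_weight_vector m n lam lam v \<longrightarrow>
            (\<exists>\<mu>. even_highest_weight_vector m n lam \<mu> (verma_act m n lam (Theta m n) v)) \<and>
            (bil m n (\<lambda>k. lam k + rho m n k) (eta m n) = 0 \<longrightarrow>
               (\<exists>\<mu>. highest_weight_vector m n lam \<mu> (verma_act m n lam (Theta m n) v))))
         \<and> (\<forall>ord. admissible_order m n ord \<longrightarrow> sapovalov_element m n ord (eta m n) (Theta m n))"
  using verma_module.Theta_even_highest_weight_vector[OF assms]
    verma_module.Theta_highest_weight_vector[OF assms] Theta_sapovalov[OF assms]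
  by blast

end
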